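(* Let $\ell$ and $m$ be integers with $1\le m<\ell\le n-1$, let $T_\ell$ and $T_m$ be the random-scan Gibbs kernels targeting $\Pi$ that update, respectively, $\ell$ and $m$ components at a time, and let $Q_{\Lambda,y}$ be the kernels defined in the context. Suppose that there exists a constant $c_1\in[0,1]$ such that $$c_1\le\frac{\mathcal E_{Q_{\Lambda,y}}(g)}{\|g\|_{\Pi_{\Lambda,y}}^2}$$ for every $\Lambda\subset\{1,\dots,n\}$ with $|\Lambda|=\ell$, $M_{-\Lambda}$-a.e. $y\in\mathsf X_{-\Lambda}$, and every $g\in L_0^2(\Pi_{\Lambda,y})\setminus\{0\}$. Then, for every $f\in L_0^2(\Pi)$, $$c_1\,\mathcal E_{T_\ell}(f)\le\mathcal E_{T_m}(f)\le\mathcal E_{T_\ell}(f).$$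
   Context: $L^2$ conventions. For a probability measure $\omega$, $L_0^2(\omega)$ is the real Hilbert space of square-integrable functions with $\omega$-mean zero (modulo a.e. equality), with inner product $\langle\cdot,\cdot\rangle_\omega$ and norm $\|\cdot\|_\omega$. For a Markov kernel $K$ reversible with respect to $\omega$ and $f\in L_0^2(\omega)$, $\mathcal E_K(f)=\|f\|_\omega^2-\langle f,Kf\rangle_\omega=\tfrac12\int\int\omega(dy)K(y,dy')[f(y)-f(y')]^2$. Setting. $\mathsf X=\mathsf X_1\times\cdots\times\mathsf X_n$ is a product of Polish spaces with Borel $\sigma$-algebras, and $\Pi$ is a probability measure on $\mathsf X$. Write $[n]=\{1,\dots,n\}$. For $\Lambda\subset[n]$ with $1\le|\Lambda|\le n-1$ and $x\in\mathsf X$, let $x_\Lambda=(x_i)_{i\in\Lambda}$, $x_{-\Lambda}=(x_i)_{i\notin\Lambda}$, $\mathsf X_\Lambda=\{x_\Lambda:x\in\mathsf X\}$, $\mathsf X_{-\Lambda}=\{x_{-\Lambda}:x\in\mathsf X\}$. For $X\sim\Pi$, $M_{-\Lambda}$ is the distribution of $X_{-\Lambda}$ and $\Pi_{\Lambda,y}$ is the conditional distribution of $X_\Lambda$ given $X_{-\Lambda}=y$. With $\delta$ denoting a point mass, for $r\in\{1,\dots,n-1\}$, $$T_r(x,dx')=\binom nr^{-1}\sum_{\Lambda\subset[n],\,|\Lambda|=r}\Pi_{\Lambda,x_{-\Lambda}}(dx'_\Lambda)\,\delta_{x_{-\Lambda}}(dx'_{-\Lambda}).$$ For $|\Lambda|=\ell$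 and $y\in\mathsf X_{-\Lambda}$, $Q_{\Lambda,y}$ is the Markov kernel on $\mathsf X_\Lambda$ satisfying $$Q_{\Lambda,x_{-\Lambda}}(x_\Lambda,dx_\Lambda')=\binom\ell m^{-1}\sum_{\Gamma\subset\Lambda,\,|\Gamma|=m}\Pi_{\Gamma,x_{-\Gamma}}(dx'_\Gamma)\,\delta_{x_{\Lambda\setminus\Gamma}}(dx'_{\Lambda\setminus\Gamma});$$ for $M_{-\Lambda}$-a.e. $y$ it is reversible with respect to $\Pi_{\Lambda,y}$ (it is the random-scan Gibbs kernel targeting $\Pi_{\Lambda,y}$ that updates $m$ components at a time). *)

theory Defs
  imports "HOL-Probability.Probability"
begin

text \<open>
  Elements of \<open>L\<^sub>0\<^sup>2(\<omega>)\<close> are handled through representatives: equality in \<open>L\<^sub>0\<^sup>2(\<omega>)\<close> is equality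
  \<open>\<omega>\<close>-almost everywhere, so \<open>g \<noteq> 0\<close> in \<open>L\<^sub>0\<^sup>2(\<omega>)\<close> reads \<open>\<not> (AE x in \<omega>. g x = 0)\<close>.
\<close>

definition L20 :: "'b measure \<Rightarrow> ('b \<Rightarrow> real) set" where
  "L20 \<omega> = {f \<in> borel_measurable \<omega>. integrable \<omega> (\<lambda>x. (f x)\<^sup>2) \<and> (\<integral>x. f x \<partial>\<omega>) = 0}"

definition L2_inner :: "'b measure \<Rightarrow> ('b \<Rightarrow> real) \<Rightarrow> ('b \<Rightarrow> real) \<Rightarrow> real" where
  "L2_inner \<omega> f g = (\<integral>x. f x * g x \<partial>\<omega>)"

definition L2_norm :: "'b measure \<Rightarrow> ('b \<Rightarrow> real) \<Rightarrow> real" where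
  "L2_norm \<omega> f = sqrt (L2_inner \<omega> f f)"

definition kernel_apply :: "('b \<Rightarrow> 'b measure) \<Rightarrow> ('b \<Rightarrow> real) \<Rightarrow> 'b \<Rightarrow> real" where
  "kernel_apply K f x = (\<integral>x'. f x' \<partial>K x)"

definition dirichlet_form :: "'b measure \<Rightarrow> ('b \<Rightarrow> 'b measure) \<Rightarrow> ('b \<Rightarrow> real) \<Rightarrow> real" where
  "dirichlet_form \<omega> K f = (L2_norm \<omega> f)\<^sup>2 - L2_inner \<omega> f (kernel_apply K f)"

text \<open>
  The factors are topologies on subsets of a common type, so they may differ from one
  coordinate to the next. A point of \<open>\<Prod>i\<in>\<Lambda>. X i\<close> is a function that is undefined outside \<open>\<Lambda>\<close>;
  hence \<open>x\<^sub>\<Lambda>\<close> is \<open>restrict x \<Lambda>\<close>, and the point with coordinates \<open>u\<close> on \<open>\<Lambda>\<close> and \<open>v\<close> on a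
  disjoint set \<open>\<Delta>\<close> is \<open>merge \<Lambda> \<Delta> (u, v)\<close>.
\<close>

definition polish_topology :: "'a topology \<Rightarrow> bool" where
  "polish_topology X \<longleftrightarrow> completely_metrizable_space X \<and> separable_space X"

definition borel_of :: "'a topology \<Rightarrow> 'a measure" where
  "borel_of X = sigma (topspace X) {U. openin X U}"

definition prod_space :: "(nat \<Rightarrow> 'a topology) \<Rightarrow> nat set \<Rightarrow> (nat \<Rightarrow> 'a) measure" where
  "prod_space X \<Lambda> = (\<Pi>\<^sub>M i\<in>\<Lambda>. borel_of (X i))"

text \<open>
  \<open>marginal_compl n X P \<Lambda>\<close> is \<open>M\<^sub>-\<^sub>\<Lambda>\<close>, the law of the coordinates outside \<open>\<Lambda>\<close> when \<open>P\<close> is the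
  joint law of all \<open>n\<close> coordinates.
\<close>

definition marginal_compl ::
    "nat \<Rightarrow> (nat \<Rightarrow> 'a topology) \<Rightarrow> (nat \<Rightarrow> 'a) measure \<Rightarrow> nat set \<Rightarrow> (nat \<Rightarrow> 'a) measure" where
  "marginal_compl n X P \<Lambda> =
     distr P (prod_space X ({1..n} - \<Lambda>)) (\<lambda>x. restrict x ({1..n} - \<Lambda>))"

text \<open>
  \<open>conditionals n X P C\<close>: for every \<open>\<Lambda>\<close> with \<open>1 \<le> |\<Lambda>| \<le> n - 1\<close>, the kernel \<open>y \<mapsto> C \<Lambda> y\<close> is a
  version of the regular conditional distribution \<open>\<Pi>\<^sub>\<Lambda>\<^sub>,\<^sub>y\<close> of \<open>X\<^sub>\<Lambda>\<close> given \<open>X\<^sub>-\<^sub>\<Lambda> = y\<close> for \<open>X \<sim> P\<close>.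
  Such versions exist since the factors are Polish, and are unique up to \<open>M\<^sub>-\<^sub>\<Lambda>\<close>-null sets.
\<close>

definition conditionals ::
    "nat \<Rightarrow> (nat \<Rightarrow> 'a topology) \<Rightarrow> (nat \<Rightarrow> 'a) measure
      \<Rightarrow> (nat set \<Rightarrow> (nat \<Rightarrow> 'a) \<Rightarrow> (nat \<Rightarrow> 'a) measure) \<Rightarrow> bool" where
  "conditionals n X P C \<longleftrightarrow>
     (\<forall>\<Lambda>. \<Lambda> \<subseteq> {1..n} \<and> 1 \<le> card \<Lambda> \<and> card \<Lambda> \<le> n - 1 \<longrightarrow>
        C \<Lambda> \<in> prod_space X ({1..n} - \<Lambda>) \<rightarrow>\<^sub>M prob_algebra (prod_space X \<Lambda>) \<and>
        (\<forall>A\<in>sets (prod_space X \<Lambda>). \<forall>B\<in>sets (prod_space X ({1..n} - \<Lambda>)).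
           emeasure P {x \<in> space P. restrict x \<Lambda> \<in> A \<and> restrict x ({1..n} - \<Lambda>) \<in> B} =
             (\<integral>\<^sup>+y\<in>B. emeasure (C \<Lambda> y) A \<partial>marginal_compl n X P \<Lambda>)))"

text \<open>
  \<open>subset_average M \<Lambda> r \<mu>\<close> is the measure \<open>(|\<Lambda>| choose r)\<^sup>-\<^sup>1 \<Sum> \<mu> \<Gamma>\<close> on the measurable space
  underlying \<open>M\<close>, where the sum is over all \<open>\<Gamma> \<subseteq> \<Lambda>\<close> with \<open>|\<Gamma>| = r\<close>.
\<close>

definition subset_average ::
    "'b measure \<Rightarrow> nat set \<Rightarrow> nat \<Rightarrow> (nat set \<Rightarrow> 'b measure) \<Rightarrow> 'b measure" where
  "subset_average M \<Lambda> r \<mu> = measure_of (space M) (sets M)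
     (\<lambda>A. (\<Sum>\<Gamma> | \<Gamma> \<subseteq> \<Lambda> \<and> card \<Gamma> = r. emeasure (\<mu> \<Gamma>) A) / of_nat (card \<Lambda> choose r))"

text \<open>
  In both kernels the product of a conditional law with a point mass is the image of the
  conditional law under the map that keeps the remaining coordinates fixed.
\<close>

definition gibbs_T ::
    "nat \<Rightarrow> (nat \<Rightarrow> 'a topology) \<Rightarrow> (nat set \<Rightarrow> (nat \<Rightarrow> 'a) \<Rightarrow> (nat \<Rightarrow> 'a) measure)
      \<Rightarrow> nat \<Rightarrow> (nat \<Rightarrow> 'a) \<Rightarrow> (nat \<Rightarrow> 'a) measure" where
  "gibbs_T n X C r x =
     subset_average (prod_space X {1..n}) {1..n} r
       (\<lambda>\<Lambda>. distr (C \<Lambda> (restrict x ({1..n} - \<Lambda>))) (prod_space X {1..n})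
               (\<lambda>z. merge \<Lambda> ({1..n} - \<Lambda>) (z, x)))"

text \<open>
  In \<open>gibbs_Q n X C m \<Lambda> y u\<close>, which is \<open>Q\<^sub>\<Lambda>\<^sub>,\<^sub>y(u, \<cdot>)\<close>, updating \<open>\<Gamma> \<subseteq> \<Lambda>\<close> conditions on the
  point \<open>x\<^sub>-\<^sub>\<Gamma>\<close> with coordinates \<open>u\<close> on \<open>\<Lambda> - \<Gamma>\<close> and \<open>y\<close> outside \<open>\<Lambda>\<close>.
\<close>

definition gibbs_Q ::
    "nat \<Rightarrow> (nat \<Rightarrow> 'a topology) \<Rightarrow> (nat set \<Rightarrow> (nat \<Rightarrow> 'a) \<Rightarrow> (nat \<Rightarrow> 'a) measure)
      \<Rightarrow> nat \<Rightarrow> nat set \<Rightarrow> (nat \<Rightarrow> 'a) \<Rightarrow> (nat \<Rightarrow> 'a) \<Rightarrow> (nat \<Rightarrow> 'a) measure" where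
  "gibbs_Q n X C m \<Lambda> y u =
     subset_average (prod_space X \<Lambda>) \<Lambda> m
       (\<lambda>\<Gamma>. distr (C \<Gamma> (merge (\<Lambda> - \<Gamma>) ({1..n} - \<Lambda>) (u, y))) (prod_space X \<Lambda>)
               (\<lambda>z. merge \<Gamma> (\<Lambda> - \<Gamma>) (z, u)))"

end

theory Submission
  imports Defs
begin

text \<open>
  Let \<open>K\<^sub>\<Lambda>\<close> be the kernel that resamples the block \<open>\<Lambda>\<close>; it acts on \<open>L\<^sup>2\<close> as the conditional expectation
  given \<open>x\<^sub>-\<^sub>\<Lambda>\<close>, so its Dirichlet form is the squared norm of the residual \<open>f - K\<^sub>\<Lambda> f\<close>. For \<open>\<Gamma> \<subseteq> \<Lambda>\<close>
  the function \<open>K\<^sub>\<Lambda> f\<close> is invariant under \<open>K\<^sub>\<Gamma>\<close>, so the \<open>K\<^sub>\<Gamma>\<close>-form of \<open>f\<close> equals that of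
  \<open>h = f - K\<^sub>\<Lambda> f\<close>. It is therefore at most the squared norm of \<open>h\<close>, which is the \<open>K\<^sub>\<Lambda>\<close>-form of \<open>f\<close>.
  Conversely, the section of \<open>h\<close> at \<open>x\<^sub>-\<^sub>\<Lambda> = y\<close> lies in \<open>L\<^sub>0\<^sup>2(\<Pi>\<^sub>\<Lambda>\<^sub>,\<^sub>y)\<close>; integrating the spectral gap
  inequality for \<open>Q\<^sub>\<Lambda>\<^sub>,\<^sub>y\<close> over \<open>y\<close> bounds \<open>c\<^sub>1\<close> times the \<open>K\<^sub>\<Lambda>\<close>-form by the average of the
  \<open>K\<^sub>\<Gamma>\<close>-forms over \<open>\<Gamma> \<subseteq> \<Lambda>\<close> with \<open>|\<Gamma>| = m\<close>. Both bounds are then averaged over \<open>\<Lambda>\<close>.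
\<close>

section \<open>Square-integrable functions\<close>

definition square_integrable :: "'b measure \<Rightarrow> ('b \<Rightarrow> real) \<Rightarrow> bool" where
  "square_integrable M f \<longleftrightarrow> f \<in> borel_measurable M \<and> integrable M (\<lambda>x. (f x)\<^sup>2)"

lemma square_integrableD:
  assumes "square_integrable M f"
  shows "f \<in> borel_measurable M" "integrable M (\<lambda>x. (f x)\<^sup>2)"
  using assms by (auto simp: square_integrable_def)

lemma square_integrable_mult:
  assumes f: "square_integrable M f" and g: "square_integrable M g"
  shows "integrable M (\<lambda>x. f x * g x)"
proof (rule Bochner_Integration.integrable_bound)
  note [measurable] = square_integrableD(1)[OF f] square_integrableD(1)[OF g]
  show "integrable M (\<lambda>x. (f x)\<^sup>2 + (g x)\<^sup>2)"
    using f g by (auto simp: square_integrable_def)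
  show "(\<lambda>x. f x * g x) \<in> borel_measurable M" by measurable
  have "\<bar>a * b\<bar> \<le> a\<^sup>2 + b\<^sup>2" for a b :: real
    using sum_squares_bound[of "\<bar>a\<bar>" "\<bar>b\<bar>"] abs_ge_zero[of "a * b"]
    unfolding abs_mult power2_abs by linarith
  then show "AE x in M. norm (f x * g x) \<le> norm ((f x)\<^sup>2 + (g x)\<^sup>2)"
    by simp
qed

lemma square_integrable_diff:
  assumes f: "square_integrable M f" and g: "square_integrable M g"
  shows "square_integrable M (\<lambda>x. f x - g x)"
  unfolding square_integrable_def
proof
  note [measurable] = square_integrableD(1)[OF f] square_integrableD(1)[OF g]
  show "(\<lambda>x. f x - g x) \<in> borel_measurable M" by measurable
  show "integrable M (\<lambda>x. (f x - g x)\<^sup>2)"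
    unfolding power2_diff
    using square_integrableD(2)[OF f] square_integrableD(2)[OF g] square_integrable_mult[OF f g]
    by (auto simp: mult.assoc)
qed

lemma square_integrable_sum:
  assumes "\<And>i. i \<in> S \<Longrightarrow> square_integrable M (f i)"
  shows "square_integrable M (\<lambda>x. \<Sum>i\<in>S. f i x)"
  using assms
proof (induction S rule: infinite_finite_induct)
  case (insert i S)
  \<comment> \<open>The sum is written as \<open>f i x - (0 - s)\<close>, so that closure under
    differences suffices.\<close>
  then have "square_integrable M (\<lambda>x. f i x - (0 - (\<Sum>i\<in>S. f i x)))"
    by (intro square_integrable_diff) (auto simp: square_integrable_def)
  with insert show ?case by simp
qed (auto simp: square_integrable_def)

lemma (in finite_measure) square_integrable_integrable:
  "square_integrable M f \<Longrightarrow> integrable M f"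
  using square_integrable_imp_integrable by (auto simp: square_integrable_def)

section \<open>Markov kernels with a stationary law\<close>

lemma dirichlet_form_eq:
  "dirichlet_form M K f = (\<integral>x. (f x)\<^sup>2 \<partial>M) - (\<integral>x. f x * kernel_apply K f x \<partial>M)"
  by (simp add: dirichlet_form_def L2_norm_def L2_inner_def power2_eq_square)

text \<open>Stationarity lets null sets and integrability pass from \<open>M\<close> to
  \<open>K x\<close> for almost every \<open>x\<close>; this makes \<open>kernel_apply K\<close>
  usable on functions known only up to null sets.\<close>

locale stationary_kernel = prob_space M for M :: "'b measure" +
  fixes K :: "'b \<Rightarrow> 'b measure"
  assumes kernel[measurable]: "K \<in> M \<rightarrow>\<^sub>M prob_algebra M"
    and stationary: "A \<in> sets M \<Longrightarrow> (\<integral>\<^sup>+x. emeasure (K x) A \<partial>M) = emeasure M A"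
begin

lemma kernel_subprob[measurable]: "K \<in> M \<rightarrow>\<^sub>M subprob_algebra M"
  using kernel by (rule measurable_prob_algebraD)

lemma prob_space_kernel: "x \<in> space M \<Longrightarrow> prob_space (K x)"
  using measurable_space[OF kernel] by (simp add: space_prob_algebra)

lemma sets_kernel: "x \<in> space M \<Longrightarrow> sets (K x) = sets M"
  using measurable_space[OF kernel] by (simp add: space_prob_algebra)

lemma borel_measurable_kernel:
  "x \<in> space M \<Longrightarrow> f \<in> borel_measurable M \<Longrightarrow> f \<in> borel_measurable (K x)"
  using measurable_cong_sets[OF sets_kernel refl] by blast

text \<open>Stationarity as an identity of measures: the general rules for \<open>bind\<close> then
  turn integrals and null sets of \<open>M\<close> into iterated ones.\<close>

lemma bind_kernel: "M \<bind> K = M"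
proof (rule measure_eqI)
  show sets: "sets (M \<bind> K) = sets M"
    by (rule sets_bind[OF sets_kernel not_empty])
  fix A assume "A \<in> sets (M \<bind> K)"
  then have "A \<in> sets M" by (simp add: sets)
  then show "emeasure (M \<bind> K) A = emeasure M A"
    using emeasure_bind[OF not_empty kernel_subprob] stationary by simp
qed

lemma nn_integral_kernel:
  "f \<in> borel_measurable M \<Longrightarrow> (\<integral>\<^sup>+x. \<integral>\<^sup>+y. f y \<partial>K x \<partial>M) = (\<integral>\<^sup>+x. f x \<partial>M)"
  using nn_integral_bind[OF _ kernel_subprob, of f] by (simp add: bind_kernel)

lemma AE_kernel:
  assumes "Measurable.pred M Q" "AE x in M. Q x"
  shows "AE x in M. AE y in K x. Q y"
  using AE_bind[OF kernel_subprob assms(1), unfolded bind_kernel] assms(2) by simp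

lemma borel_measurable_apply[measurable]:
  assumes [measurable]: "f \<in> borel_measurable M"
  shows "kernel_apply K f \<in> borel_measurable M"
  unfolding kernel_apply_def by measurable

text \<open>The iterated integral of \<open>norm (f y)\<close> is finite by stationarity, so the
  inner integral is finite almost everywhere. Where \<open>f\<close> is not integrable under
  \<open>K x\<close>, \<open>kernel_apply K f x\<close> has the Bochner default value 0.\<close>

lemma AE_integrable_kernel:
  fixes f :: "'b \<Rightarrow> real"
  assumes f: "integrable M f"
  shows "AE x in M. integrable (K x) f"
proof -
  note [measurable] = borel_measurable_integrable[OF f]
  have "(\<integral>\<^sup>+x. \<integral>\<^sup>+y. norm (f y) \<partial>K x \<partial>M) \<noteq> \<infinity>"
    using f by (subst nn_integral_kernel) (auto simp: integrable_iff_bounded)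
  then have "AE x in M. (\<integral>\<^sup>+y. norm (f y) \<partial>K x) \<noteq> \<infinity>"
    by (intro nn_integral_PInf_AE) auto
  then show ?thesis
    by (rule AE_mp)
      (auto simp: integrable_iff_bounded less_top intro: borel_measurable_kernel)
qed

text \<open>For nonnegative functions both claims come from \<open>nn_integral_kernel\<close>; the
  general case splits \<open>f\<close> into positive and negative parts.\<close>

lemma
  assumes f: "integrable M f"
  shows integrable_apply: "integrable M (kernel_apply K f)"
    and integral_apply: "(\<integral>x. kernel_apply K f x \<partial>M) = (\<integral>x. f x \<partial>M)"
proof -
  have *: "integrable M (kernel_apply K g) \<and> (\<integral>x. kernel_apply K g x \<partial>M) = (\<integral>x. g x \<partial>M)"
    if g: "integrable M g" and nonneg: "\<And>x. 0 \<le> g x" for g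
  proof -
    note [measurable] = borel_measurable_integrable[OF g]
    have "(\<integral>\<^sup>+x. ennreal (kernel_apply K g x) \<partial>M) = (\<integral>\<^sup>+x. \<integral>\<^sup>+y. g y \<partial>K x \<partial>M)"
      using AE_integrable_kernel[OF g]
      by (intro nn_integral_cong_AE, elim AE_mp)
        (auto simp: kernel_apply_def nn_integral_eq_integral nonneg)
    also have "\<dots> = (\<integral>\<^sup>+x. g x \<partial>M)" by (rule nn_integral_kernel) simp
    also have "\<dots> = ennreal (\<integral>x. g x \<partial>M)"
      by (rule nn_integral_eq_integral[OF g]) (simp add: nonneg)
    finally have eq: "(\<integral>\<^sup>+x. ennreal (kernel_apply K g x) \<partial>M) = ennreal (\<integral>x. g x \<partial>M)" .
    have pos: "0 \<le> kernel_apply K g x" for x by (simp add: kernel_apply_def nonneg)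
    show ?thesis
      using nn_integral_eq_integrable[of "kernel_apply K g" M "\<integral>x. g x \<partial>M"] eq pos nonneg
      by (simp add: integral_nonneg_AE)
  qed
  define p q where "p = (\<lambda>x. max 0 (f x))" and "q = (\<lambda>x. max 0 (- f x))"
  have p: "integrable M p" and q: "integrable M q"
    using f by (auto simp: p_def q_def)
  have fpq: "f = (\<lambda>x. p x - q x)" by (auto simp: p_def q_def)
  note [measurable] = borel_measurable_integrable[OF f] borel_measurable_integrable[OF p]
    borel_measurable_integrable[OF q]
  \<comment> \<open>Linearity of \<open>kernel_apply K\<close> is available where both parts are
    integrable under \<open>K x\<close>, hence almost everywhere.\<close>
  have eq: "AE x in M. kernel_apply K f x = kernel_apply K p x - kernel_apply K q x"
    using AE_integrable_kernel[OF p] AE_integrable_kernel[OF q]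
    by eventually_elim (simp add: kernel_apply_def fpq)
  have P: "integrable M (kernel_apply K p)" "(\<integral>x. kernel_apply K p x \<partial>M) = (\<integral>x. p x \<partial>M)"
   and Q: "integrable M (kernel_apply K q)" "(\<integral>x. kernel_apply K q x \<partial>M) = (\<integral>x. q x \<partial>M)"
    using *[OF p] *[OF q] by (auto simp: p_def q_def)
  have "integrable M (\<lambda>x. kernel_apply K p x - kernel_apply K q x)" using P Q by simp
  then show "integrable M (kernel_apply K f)"
    by (rule Bochner_Integration.integrable_cong_AE_imp) (use eq in auto)
  have "(\<integral>x. kernel_apply K f x \<partial>M) = (\<integral>x. kernel_apply K p x - kernel_apply K q x \<partial>M)"
    by (rule integral_cong_AE) (use eq in auto)
  also have "\<dots> = (\<integral>x. f x \<partial>M)" using P Q p q by (simp add: fpq)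
  finally show "(\<integral>x. kernel_apply K f x \<partial>M) = (\<integral>x. f x \<partial>M)" .
qed

lemma AE_square_integrable_kernel:
  assumes "square_integrable M f"
  shows "AE x in M. square_integrable (K x) f"
  using AE_integrable_kernel[OF square_integrableD(2)[OF assms]] AE_space
  by eventually_elim
    (simp add: square_integrable_def borel_measurable_kernel square_integrableD(1)[OF assms])

text \<open>Jensen's inequality \<open>(K f)\<^sup>2 \<le> K (f\<^sup>2)\<close>, read as
  nonnegativity of the variance of \<open>f\<close> under \<open>K x\<close>; the right side is
  integrable by stationarity.\<close>

lemma square_integrable_apply:
  assumes f: "square_integrable M f"
  shows "square_integrable M (kernel_apply K f)"
  unfolding square_integrable_def
proof
  note [measurable] = square_integrableD(1)[OF f]
  show "kernel_apply K f \<in> borel_measurable M" by measurable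
  have le: "AE x in M. (kernel_apply K f x)\<^sup>2 \<le> kernel_apply K (\<lambda>y. (f y)\<^sup>2) x"
    using AE_square_integrable_kernel[OF f] AE_space
  proof eventually_elim
    case (elim x)
    interpret Kx: prob_space "K x" using prob_space_kernel elim by simp
    have "0 \<le> Kx.variance f" by (rule Kx.variance_positive)
    with elim show ?case
      by (simp add: kernel_apply_def Kx.variance_eq square_integrableD Kx.square_integrable_integrable)
  qed
  show "integrable M (\<lambda>x. (kernel_apply K f x)\<^sup>2)"
    by (rule Bochner_Integration.integrable_bound[OF integrable_apply[OF square_integrableD(2)[OF f]]])
      (use le in auto)
qed

end

section \<open>Kernels acting as conditional expectations\<close>

text \<open>
  The additional assumption says that \<open>K\<close> acts as a conditional expectation: \<open>K x\<close> lives on the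
  fibre of \<open>x\<close>, and \<open>K f\<close> is constant on fibres.
\<close>

locale proper_kernel = stationary_kernel M K for M :: "'b measure" and K +
  assumes proper: "f \<in> borel_measurable M \<Longrightarrow> x \<in> space M \<Longrightarrow>
    AE y in K x. kernel_apply K f y = kernel_apply K f x"
begin

text \<open>Stands in for measurability with respect to the sigma-algebra of the fibres, expressed
  through the kernel alone.\<close>

definition invariant :: "('b \<Rightarrow> real) \<Rightarrow> bool" where
  "invariant \<phi> \<longleftrightarrow> \<phi> \<in> borel_measurable M \<and> (\<forall>x\<in>space M. AE y in K x. \<phi> y = \<phi> x)"

lemma invariant_apply: "f \<in> borel_measurable M \<Longrightarrow> invariant (kernel_apply K f)"
  using proper by (simp add: invariant_def)

text \<open>Taking out what is known. Under \<open>K x\<close> the factor \<open>\<phi>\<close> is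
  almost surely the constant \<open>\<phi> x\<close>, and a constant factor can be pulled out of a
  Bochner integral even at its default value, so the identity holds at every point.\<close>

lemma apply_invariant_mult:
  assumes \<phi>: "invariant \<phi>" and f: "f \<in> borel_measurable M" and x: "x \<in> space M"
  shows "kernel_apply K (\<lambda>y. \<phi> y * f y) x = \<phi> x * kernel_apply K f x"
proof -
  have [measurable]: "\<phi> \<in> borel_measurable (K x)" "f \<in> borel_measurable (K x)"
    using \<phi> f x borel_measurable_kernel by (auto simp: invariant_def)
  have "(\<integral>y. \<phi> y * f y \<partial>K x) = (\<integral>y. \<phi> x * f y \<partial>K x)"
    by (rule integral_cong_AE) (use \<phi> x in \<open>auto simp: invariant_def elim: AE_mp\<close>)
  then show ?thesis by (simp add: kernel_apply_def)
qed

text \<open>The residual \<open>f - K f\<close> is orthogonal to every invariant function: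
  \<open>K\<close> is the orthogonal projection onto them.\<close>

lemma integral_invariant_mult:
  assumes \<phi>: "invariant \<phi>" "square_integrable M \<phi>" and f: "square_integrable M f"
  shows "(\<integral>x. \<phi> x * kernel_apply K f x \<partial>M) = (\<integral>x. \<phi> x * f x \<partial>M)"
proof -
  have "(\<integral>x. \<phi> x * kernel_apply K f x \<partial>M) = (\<integral>x. kernel_apply K (\<lambda>y. \<phi> y * f y) x \<partial>M)"
    by (rule Bochner_Integration.integral_cong)
      (auto simp: apply_invariant_mult[OF \<phi>(1) square_integrableD(1)[OF f]])
  also have "\<dots> = (\<integral>x. \<phi> x * f x \<partial>M)"
    by (rule integral_apply[OF square_integrable_mult[OF \<phi>(2) f]])
  finally show ?thesis .
qed

text \<open>Pythagoras: \<open>K f\<close> is itself invariant, so its squared norm equals its inner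
  product with \<open>f\<close>; the rest is expanding the square.\<close>

lemma dirichlet_form_eq_residual:
  assumes f: "square_integrable M f"
  shows "dirichlet_form M K f = (\<integral>x. (f x - kernel_apply K f x)\<^sup>2 \<partial>M)"
proof -
  let ?g = "kernel_apply K f"
  have g: "square_integrable M ?g" by (rule square_integrable_apply[OF f])
  have "(\<integral>x. ?g x * ?g x \<partial>M) = (\<integral>x. ?g x * f x \<partial>M)"
    by (rule integral_invariant_mult[OF invariant_apply g f]) (rule square_integrableD(1)[OF f])
  then show ?thesis
    using square_integrableD(2)[OF f] square_integrableD(2)[OF g] square_integrable_mult[OF f g]
    by (simp add: dirichlet_form_eq power2_diff mult.assoc) (simp add: power2_eq_square mult.commute)
qed

text \<open>The subtracted inner product of \<open>f\<close> and \<open>K f\<close> is the squared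
  norm of \<open>K f\<close>, hence nonnegative.\<close>

lemma dirichlet_form_le:
  assumes f: "square_integrable M f"
  shows "dirichlet_form M K f \<le> (\<integral>x. (f x)\<^sup>2 \<partial>M)"
proof -
  let ?g = "kernel_apply K f"
  have g: "square_integrable M ?g" by (rule square_integrable_apply[OF f])
  have "(\<integral>x. ?g x * ?g x \<partial>M) = (\<integral>x. ?g x * f x \<partial>M)"
    by (rule integral_invariant_mult[OF invariant_apply g f]) (rule square_integrableD(1)[OF f])
  moreover have "0 \<le> (\<integral>x. ?g x * ?g x \<partial>M)" by simp
  ultimately show ?thesis by (simp add: dirichlet_form_eq mult.commute)
qed

text \<open>The kernel fixes \<open>\<phi>\<close>, so subtracting \<open>\<phi>\<close> leaves the
  residual unchanged almost everywhere.\<close>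

lemma dirichlet_form_diff_invariant:
  assumes \<phi>: "invariant \<phi>" "square_integrable M \<phi>" and f: "square_integrable M f"
  shows "dirichlet_form M K (\<lambda>x. f x - \<phi> x) = dirichlet_form M K f"
proof -
  let ?h = "\<lambda>x. f x - \<phi> x"
  have h: "square_integrable M ?h" by (rule square_integrable_diff[OF f \<phi>(2)])
  note [measurable] = square_integrableD(1)[OF f] square_integrableD(1)[OF \<phi>(2)]
  have eq: "AE x in M. ?h x - kernel_apply K ?h x = f x - kernel_apply K f x"
    using AE_square_integrable_kernel[OF f] AE_square_integrable_kernel[OF \<phi>(2)] AE_space
  proof eventually_elim
    case (elim x)
    interpret Kx: prob_space "K x" using prob_space_kernel elim by simp
    \<comment> \<open>\<open>\<phi>\<close> is taken out of the product of \<open>\<phi>\<close>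
      with the constant 1, and \<open>K x\<close> has total mass 1.\<close>
    have "kernel_apply K \<phi> x = \<phi> x"
      using apply_invariant_mult[OF \<phi>(1), of "\<lambda>_. 1" x] elim by (simp add: kernel_apply_def Kx.prob_space)
    with elim show ?case
      by (simp add: kernel_apply_def Kx.square_integrable_integrable)
  qed
  have "AE x in M. (?h x - kernel_apply K ?h x)\<^sup>2 = (f x - kernel_apply K f x)\<^sup>2"
    using eq by eventually_elim (simp only:)
  then show ?thesis
    unfolding dirichlet_form_eq_residual[OF h] dirichlet_form_eq_residual[OF f]
    by (intro integral_cong_AE) auto
qed

end

text \<open>Meant for nested blocks: \<open>K\<close> resamples the smaller block and
  \<open>L\<close> the larger one. The form of \<open>K\<close> sees only the residual of
  \<open>L\<close>, whose squared norm is the form of \<open>L\<close>.\<close>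

lemma dirichlet_form_le_of_invariant:
  assumes K: "proper_kernel M K" and L: "proper_kernel M L" and f: "square_integrable M f"
    and inv: "proper_kernel.invariant M K (kernel_apply L f)"
  shows "dirichlet_form M K f \<le> dirichlet_form M L f"
proof -
  interpret K: proper_kernel M K by fact
  interpret L: proper_kernel M L by fact
  have g: "square_integrable M (kernel_apply L f)" by (rule L.square_integrable_apply[OF f])
  have "dirichlet_form M K f = dirichlet_form M K (\<lambda>x. f x - kernel_apply L f x)"
    by (rule K.dirichlet_form_diff_invariant[OF inv g f, symmetric])
  also have "\<dots> \<le> dirichlet_form M L f"
    unfolding L.dirichlet_form_eq_residual[OF f]
    by (rule K.dirichlet_form_le[OF square_integrable_diff[OF f g]])
  finally show ?thesis .
qed

section \<open>Averages of measures over subsets of a fixed size\<close>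

context
  fixes M :: "'b measure" and \<Lambda> :: "nat set" and r :: nat
  assumes fin: "finite \<Lambda>" and r: "r \<le> card \<Lambda>"
begin

text \<open>The average is the mixture of the measures \<open>\<mu> \<Gamma>\<close> with
  \<open>\<Gamma>\<close> drawn uniformly, that is \<open>U \<bind> \<mu>\<close>. This
  identification shows that the set function is a probability measure and yields its
  integrals.\<close>

lemma
  assumes \<mu>: "\<And>\<Gamma>. \<Gamma> \<subseteq> \<Lambda> \<Longrightarrow> card \<Gamma> = r \<Longrightarrow> \<mu> \<Gamma> \<in> space (prob_algebra M)"
  shows prob_algebra_subset_average: "subset_average M \<Lambda> r \<mu> \<in> space (prob_algebra M)"
    and nn_integral_subset_average: "\<And>f. f \<in> borel_measurable M \<Longrightarrow>
      (\<integral>\<^sup>+x. f x \<partial>subset_average M \<Lambda> r \<mu>)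
        = (\<Sum>\<Gamma> | \<Gamma> \<subseteq> \<Lambda> \<and> card \<Gamma> = r. \<integral>\<^sup>+x. f x \<partial>\<mu> \<Gamma>) / of_nat (card \<Lambda> choose r)"
proof -
  define S where "S = {\<Gamma>. \<Gamma> \<subseteq> \<Lambda> \<and> card \<Gamma> = r}"
  define U where "U = uniform_count_measure S"
  have S: "finite S" "card S = card \<Lambda> choose r"
    using fin by (simp_all add: S_def n_subsets)
  \<comment> \<open>The bound \<open>r \<le> card \<Lambda>\<close> enters here: the uniform law
    needs at least one subset to draw.\<close>
  have "card S > 0" using r by (simp add: S)
  then have "S \<noteq> {}" by auto
  have space_U: "space U = S" by (simp add: U_def space_uniform_count_measure)
  have U: "(\<integral>\<^sup>+\<Gamma>. g \<Gamma> \<partial>U) = (\<Sum>\<Gamma>\<in>S. g \<Gamma>) / of_nat (card \<Lambda> choose r)" for g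
  proof -
    have "(\<integral>\<^sup>+\<Gamma>. g \<Gamma> \<partial>U) = (\<Sum>\<Gamma>\<in>S. g \<Gamma> * ennreal (1 / card S))"
      by (simp add: U_def uniform_count_measure_def nn_integral_point_measure_finite S mult.commute)
    also have "ennreal (1 / card S) = inverse (of_nat (card S))"
      using \<open>card S > 0\<close> by (simp add: inverse_ennreal[symmetric] divide_inverse ennreal_of_nat_eq_real_of_nat)
    finally show ?thesis by (simp add: S divide_ennreal_def sum_distrib_right)
  qed
  have "\<mu> \<in> count_space S \<rightarrow>\<^sub>M prob_algebra M" using \<mu> by (simp add: S_def)
  then have \<mu>U: "\<mu> \<in> U \<rightarrow>\<^sub>M prob_algebra M"
    by (simp add: U_def measurable_cong_sets[OF sets_uniform_count_measure_count_space refl])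
  have \<mu>U': "\<mu> \<in> U \<rightarrow>\<^sub>M subprob_algebra M" by (rule measurable_prob_algebraD[OF \<mu>U])
  have ne: "space U \<noteq> {}" by (simp add: space_U \<open>S \<noteq> {}\<close>)
  have sets: "sets (U \<bind> \<mu>) = sets M"
    by (rule sets_bind[OF _ ne]) (use \<mu> in \<open>auto simp: space_U S_def space_prob_algebra\<close>)
  have em: "emeasure (U \<bind> \<mu>) A = (\<Sum>\<Gamma>\<in>S. emeasure (\<mu> \<Gamma>) A) / of_nat (card \<Lambda> choose r)"
    if "A \<in> sets M" for A
    by (simp add: emeasure_bind[OF ne \<mu>U' that] U)
  have eq: "subset_average M \<Lambda> r \<mu> = U \<bind> \<mu>"
  proof -
    have "subset_average M \<Lambda> r \<mu> = measure_of (space (U \<bind> \<mu>)) (sets (U \<bind> \<mu>)) (emeasure (U \<bind> \<mu>))"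
      unfolding subset_average_def sets sets_eq_imp_space_eq[OF sets] S_def[symmetric]
      by (rule measure_of_eq) (auto simp: em sets.sigma_sets_eq sets.space_closed)
    then show ?thesis by (simp add: measure_of_of_measure)
  qed
  have "prob_space U" unfolding U_def by (rule prob_space_uniform_count_measure) fact+
  then have "U \<in> space (prob_algebra U)" by (simp add: space_prob_algebra)
  \<comment> \<open>The rule for \<open>bind\<close> speaks of parametrised families; a dummy
    parameter of type \<open>unit\<close> turns it into a statement about one measure.\<close>
  then have "(\<lambda>_::unit. U \<bind> \<mu>) \<in> count_space UNIV \<rightarrow>\<^sub>M prob_algebra M"
    by (intro measurable_bind_prob_space[OF measurable_const \<mu>U])
  from measurable_space[OF this] show "subset_average M \<Lambda> r \<mu> \<in> space (prob_algebra M)"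
    by (simp add: eq)
  show "(\<integral>\<^sup>+x. f x \<partial>subset_average M \<Lambda> r \<mu>)
        = (\<Sum>\<Gamma> | \<Gamma> \<subseteq> \<Lambda> \<and> card \<Gamma> = r. \<integral>\<^sup>+x. f x \<partial>\<mu> \<Gamma>) / of_nat (card \<Lambda> choose r)"
    if "f \<in> borel_measurable M" for f
    unfolding eq by (simp add: nn_integral_bind[OF that \<mu>U'] U S_def)
qed

lemma measurable_subset_average:
  assumes K: "\<And>\<Gamma>. \<Gamma> \<subseteq> \<Lambda> \<Longrightarrow> card \<Gamma> = r \<Longrightarrow> K \<Gamma> \<in> N \<rightarrow>\<^sub>M prob_algebra M"
  shows "(\<lambda>x. subset_average M \<Lambda> r (\<lambda>\<Gamma>. K \<Gamma> x)) \<in> N \<rightarrow>\<^sub>M prob_algebra M"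
proof (rule measurable_prob_algebraI)
  have sp: "subset_average M \<Lambda> r (\<lambda>\<Gamma>. K \<Gamma> x) \<in> space (prob_algebra M)" if "x \<in> space N" for x
    by (rule prob_algebra_subset_average) (use measurable_space[OF K] that in auto)
  then show "prob_space (subset_average M \<Lambda> r (\<lambda>\<Gamma>. K \<Gamma> x))" if "x \<in> space N" for x
    using that by (simp add: space_prob_algebra)
  show "(\<lambda>x. subset_average M \<Lambda> r (\<lambda>\<Gamma>. K \<Gamma> x)) \<in> N \<rightarrow>\<^sub>M subprob_algebra M"
  proof (rule measurable_subprob_algebra)
    show "subprob_space (subset_average M \<Lambda> r (\<lambda>\<Gamma>. K \<Gamma> x))" "sets (subset_average M \<Lambda> r (\<lambda>\<Gamma>. K \<Gamma> x)) = sets M"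
      if "x \<in> space N" for x
      using sp[OF that] by (auto simp: space_prob_algebra intro: prob_space_imp_subprob_space)
    fix A assume A: "A \<in> sets M"
    have "(\<lambda>x. (\<Sum>\<Gamma> | \<Gamma> \<subseteq> \<Lambda> \<and> card \<Gamma> = r. emeasure (K \<Gamma> x) A) / of_nat (card \<Lambda> choose r)) \<in> borel_measurable N"
      using measurable_compose[OF measurable_prob_algebraD[OF K] measurable_emeasure_subprob_algebra[OF A]]
      by (intro borel_measurable_divide_ennreal borel_measurable_sum) auto
    also have "?this \<longleftrightarrow> (\<lambda>x. emeasure (subset_average M \<Lambda> r (\<lambda>\<Gamma>. K \<Gamma> x)) A) \<in> borel_measurable N"
    proof (rule measurable_cong)
      fix x assume x: "x \<in> space N"
      have Kx: "\<Gamma> \<subseteq> \<Lambda> \<Longrightarrow> card \<Gamma> = r \<Longrightarrow> K \<Gamma> x \<in> space (prob_algebra M)" for \<Gamma>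
        using measurable_space[OF K] x by auto
      \<comment> \<open>The mass of \<open>A\<close> is recovered by integrating its indicator,
        since the integral formula is already known.\<close>
      have "emeasure (subset_average M \<Lambda> r (\<lambda>\<Gamma>. K \<Gamma> x)) A
          = (\<integral>\<^sup>+y. indicator A y \<partial>subset_average M \<Lambda> r (\<lambda>\<Gamma>. K \<Gamma> x))"
        using A sp[OF x] by (simp add: space_prob_algebra)
      also have "\<dots> = (\<Sum>\<Gamma> | \<Gamma> \<subseteq> \<Lambda> \<and> card \<Gamma> = r. \<integral>\<^sup>+y. indicator A y \<partial>K \<Gamma> x) / of_nat (card \<Lambda> choose r)"
        using Kx A by (intro nn_integral_subset_average) auto
      also have "(\<Sum>\<Gamma> | \<Gamma> \<subseteq> \<Lambda> \<and> card \<Gamma> = r. \<integral>\<^sup>+y. indicator A y \<partial>K \<Gamma> x)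
          = (\<Sum>\<Gamma> | \<Gamma> \<subseteq> \<Lambda> \<and> card \<Gamma> = r. emeasure (K \<Gamma> x) A)"
        using Kx A by (intro sum.cong) (auto simp: space_prob_algebra)
      finally show "(\<Sum>\<Gamma> | \<Gamma> \<subseteq> \<Lambda> \<and> card \<Gamma> = r. emeasure (K \<Gamma> x) A) / of_nat (card \<Lambda> choose r)
          = emeasure (subset_average M \<Lambda> r (\<lambda>\<Gamma>. K \<Gamma> x)) A" ..
    qed
    finally show "(\<lambda>x. emeasure (subset_average M \<Lambda> r (\<lambda>\<Gamma>. K \<Gamma> x)) A) \<in> borel_measurable N" .
  qed
qed

text \<open>Positive and negative parts are averaged as extended nonnegative integrals;
  integrability under each \<open>\<mu> \<Gamma>\<close> makes these finite, so the real integrals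
  can be reassembled.\<close>

lemma integral_subset_average:
  fixes f :: "'b \<Rightarrow> real"
  assumes \<mu>: "\<And>\<Gamma>. \<Gamma> \<subseteq> \<Lambda> \<Longrightarrow> card \<Gamma> = r \<Longrightarrow> \<mu> \<Gamma> \<in> space (prob_algebra M)"
    and f: "f \<in> borel_measurable M"
    and int: "\<And>\<Gamma>. \<Gamma> \<subseteq> \<Lambda> \<Longrightarrow> card \<Gamma> = r \<Longrightarrow> integrable (\<mu> \<Gamma>) f"
  shows "(\<integral>x. f x \<partial>subset_average M \<Lambda> r \<mu>)
    = (\<Sum>\<Gamma> | \<Gamma> \<subseteq> \<Lambda> \<and> card \<Gamma> = r. \<integral>x. f x \<partial>\<mu> \<Gamma>) / of_nat (card \<Lambda> choose r)"
proof -
  define S where "S = {\<Gamma>. \<Gamma> \<subseteq> \<Lambda> \<and> card \<Gamma> = r}"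
  define c :: real where "c = of_nat (card \<Lambda> choose r)"
  have "c > 0" using r by (simp add: c_def)
  have c: "of_nat (card \<Lambda> choose r) = ennreal c" by (simp add: c_def ennreal_of_nat_eq_real_of_nat)
  let ?A = "subset_average M \<Lambda> r \<mu>"
  have nn: "(\<integral>\<^sup>+x. ennreal (g x) \<partial>?A) = ennreal ((\<Sum>\<Gamma>\<in>S. enn2real (\<integral>\<^sup>+x. ennreal (g x) \<partial>\<mu> \<Gamma>)) / c)"
    if g: "g \<in> borel_measurable M" and fin: "\<And>\<Gamma>. \<Gamma> \<in> S \<Longrightarrow> (\<integral>\<^sup>+x. ennreal (g x) \<partial>\<mu> \<Gamma>) < \<infinity>" for g
  proof -
    have "(\<integral>\<^sup>+x. ennreal (g x) \<partial>?A) = (\<Sum>\<Gamma>\<in>S. \<integral>\<^sup>+x. ennreal (g x) \<partial>\<mu> \<Gamma>) / ennreal c"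
      unfolding S_def c[symmetric] using g by (intro nn_integral_subset_average \<mu>) auto
    also have "(\<Sum>\<Gamma>\<in>S. \<integral>\<^sup>+x. ennreal (g x) \<partial>\<mu> \<Gamma>) = (\<Sum>\<Gamma>\<in>S. ennreal (enn2real (\<integral>\<^sup>+x. ennreal (g x) \<partial>\<mu> \<Gamma>)))"
      by (rule sum.cong) (use fin in simp_all)
    finally show ?thesis
      using \<open>c > 0\<close> by (simp add: sum_ennreal sum_nonneg divide_ennreal)
  qed
  have lt: "(\<integral>\<^sup>+x. ennreal (f x) \<partial>\<mu> \<Gamma>) < \<infinity>" "(\<integral>\<^sup>+x. ennreal (- f x) \<partial>\<mu> \<Gamma>) < \<infinity>"
    "(\<integral>\<^sup>+x. ennreal (norm (f x)) \<partial>\<mu> \<Gamma>) < \<infinity>" if "\<Gamma> \<in> S" for \<Gamma>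
    using int[of \<Gamma>] that real_integrable_def[of "\<mu> \<Gamma>" f] integrable_iff_bounded[of "\<mu> \<Gamma>" f]
    unfolding S_def infinity_ennreal_def less_top[symmetric] by blast+
  have A: "sets ?A = sets M" using prob_algebra_subset_average[OF \<mu>] by (simp add: space_prob_algebra)
  have fA: "f \<in> borel_measurable ?A" using f by (simp add: measurable_cong_sets[OF A refl])
  have "(\<integral>\<^sup>+x. ennreal (norm (f x)) \<partial>?A) < \<infinity>"
    by (subst nn) (use f lt in auto)
  then have "integrable ?A f"
    unfolding integrable_iff_bounded using fA by blast
  then have "(\<integral>x. f x \<partial>?A) = enn2real (\<integral>\<^sup>+x. ennreal (f x) \<partial>?A) - enn2real (\<integral>\<^sup>+x. ennreal (- f x) \<partial>?A)"
    by (rule real_lebesgue_integral_def)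
  also have "(\<integral>\<^sup>+x. ennreal (f x) \<partial>?A) = ennreal ((\<Sum>\<Gamma>\<in>S. enn2real (\<integral>\<^sup>+x. ennreal (f x) \<partial>\<mu> \<Gamma>)) / c)"
    by (rule nn) (use f lt in auto)
  also have "(\<integral>\<^sup>+x. ennreal (- f x) \<partial>?A) = ennreal ((\<Sum>\<Gamma>\<in>S. enn2real (\<integral>\<^sup>+x. ennreal (- f x) \<partial>\<mu> \<Gamma>)) / c)"
    by (rule nn) (use f lt in auto)
  also have "enn2real (ennreal ((\<Sum>\<Gamma>\<in>S. enn2real (\<integral>\<^sup>+x. ennreal (f x) \<partial>\<mu> \<Gamma>)) / c))
      - enn2real (ennreal ((\<Sum>\<Gamma>\<in>S. enn2real (\<integral>\<^sup>+x. ennreal (- f x) \<partial>\<mu> \<Gamma>)) / c))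
      = (\<Sum>\<Gamma>\<in>S. enn2real (\<integral>\<^sup>+x. ennreal (f x) \<partial>\<mu> \<Gamma>) - enn2real (\<integral>\<^sup>+x. ennreal (- f x) \<partial>\<mu> \<Gamma>)) / c"
    using \<open>c > 0\<close> by (simp add: sum_nonneg diff_divide_distrib sum_subtractf)
  also have "\<dots> = (\<Sum>\<Gamma>\<in>S. \<integral>x. f x \<partial>\<mu> \<Gamma>) / c"
    using int by (simp add: S_def real_lebesgue_integral_def)
  finally show ?thesis by (simp add: S_def c_def)
qed

end

section \<open>Merging coordinates\<close>

lemma merge_restrict: "merge J K (restrict a J, restrict b K) = merge J K (a, b)"
  by (auto simp: merge_def fun_eq_iff)

text \<open>\<open>merge J K\<close> reads its arguments only on \<open>J\<close> and
  \<open>K\<close>, so they may be points of larger products, such as a full point \<open>x\<close>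
  in place of its restriction.\<close>

lemma measurable_merge_superset:
  assumes f: "f \<in> N \<rightarrow>\<^sub>M Pi\<^sub>M J' M" and g: "g \<in> N \<rightarrow>\<^sub>M Pi\<^sub>M K' M" and "J \<subseteq> J'" "K \<subseteq> K'"
    and L: "L = J \<union> K"
  shows "(\<lambda>x. merge J K (f x, g x)) \<in> N \<rightarrow>\<^sub>M Pi\<^sub>M L M"
proof -
  have "(\<lambda>x. merge J K (restrict (f x) J, restrict (g x) K)) \<in> N \<rightarrow>\<^sub>M Pi\<^sub>M (J \<union> K) M"
    by (rule measurable_compose[OF measurable_Pair measurable_merge])
      (rule measurable_compose[OF f measurable_restrict_subset[OF \<open>J \<subseteq> J'\<close>]]
        measurable_compose[OF g measurable_restrict_subset[OF \<open>K \<subseteq> K'\<close>]])+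
  then show ?thesis by (simp add: merge_restrict L)
qed

declare One_nat_def [simp del]

section \<open>Resampling a single block of coordinates\<close>

locale gibbs_sampler = prob_space P for P :: "(nat \<Rightarrow> 'a) measure" +
  fixes n :: nat and X :: "nat \<Rightarrow> 'a topology"
    and C :: "nat set \<Rightarrow> (nat \<Rightarrow> 'a) \<Rightarrow> (nat \<Rightarrow> 'a) measure"
  assumes sets_P: "sets P = sets (prod_space X {1..n})"
    and conditionals: "conditionals n X P C"
begin

abbreviation compl :: "nat set \<Rightarrow> nat set" where
  "compl \<Lambda> \<equiv> {1..n} - \<Lambda>"

definition block :: "nat set \<Rightarrow> bool" where
  "block \<Lambda> \<longleftrightarrow> \<Lambda> \<subseteq> {1..n} \<and> 1 \<le> card \<Lambda> \<and> card \<Lambda> \<le> n - 1"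

text \<open>The kernel \<open>K\<^sub>\<Lambda>\<close>. Its target is \<open>P\<close>, which
  carries the product sigma-algebra, so that it is a kernel on \<open>P\<close> in the sense of
  \<open>stationary_kernel\<close>.\<close>

definition update :: "nat set \<Rightarrow> (nat \<Rightarrow> 'a) \<Rightarrow> (nat \<Rightarrow> 'a) measure" where
  "update \<Lambda> x = distr (C \<Lambda> (restrict x (compl \<Lambda>))) P (\<lambda>z. merge \<Lambda> (compl \<Lambda>) (z, x))"

lemma space_P: "space P = space (prod_space X {1..n})"
  by (rule sets_eq_imp_space_eq[OF sets_P])

lemma update_eq:
  "update \<Lambda> x = distr (C \<Lambda> (restrict x (compl \<Lambda>))) (prod_space X {1..n}) (\<lambda>z. merge \<Lambda> (compl \<Lambda>) (z, x))"
  unfolding update_def by (rule distr_cong) (auto simp: sets_P)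

lemma block_subset: "block \<Lambda> \<Longrightarrow> \<Lambda> \<subseteq> {1..n}"
  by (simp add: block_def)

lemma measurable_conditional:
  "block \<Lambda> \<Longrightarrow> C \<Lambda> \<in> prod_space X (compl \<Lambda>) \<rightarrow>\<^sub>M prob_algebra (prod_space X \<Lambda>)"
  using conditionals by (simp add: conditionals_def block_def)

lemma emeasure_conditional:
  assumes "block \<Lambda>" "A \<in> sets (prod_space X \<Lambda>)" "B \<in> sets (prod_space X (compl \<Lambda>))"
  shows "emeasure P {x \<in> space P. restrict x \<Lambda> \<in> A \<and> restrict x (compl \<Lambda>) \<in> B}
    = (\<integral>\<^sup>+y\<in>B. emeasure (C \<Lambda> y) A \<partial>marginal_compl n X P \<Lambda>)"
  using assms conditionals by (simp add: conditionals_def block_def)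

lemma measurable_P_cong: "measurable P N = measurable (prod_space X {1..n}) N"
  by (rule measurable_cong_sets[OF sets_P refl])

lemma measurable_restrict_P:
  "\<Lambda> \<subseteq> {1..n} \<Longrightarrow> (\<lambda>x. restrict x \<Lambda>) \<in> P \<rightarrow>\<^sub>M prod_space X \<Lambda>"
  unfolding measurable_P_cong prod_space_def by (rule measurable_restrict_subset)

lemma restrict_compl_space: "x \<in> space P \<Longrightarrow> restrict x (compl \<Lambda>) \<in> space (prod_space X (compl \<Lambda>))"
  by (rule measurable_space[OF measurable_restrict_P]) auto

lemma conditional_at:
  assumes "block \<Lambda>" "x \<in> space P"
  shows "prob_space (C \<Lambda> (restrict x (compl \<Lambda>)))"
    "sets (C \<Lambda> (restrict x (compl \<Lambda>))) = sets (prod_space X \<Lambda>)"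
  using measurable_space[OF measurable_conditional restrict_compl_space] assms
  by (auto simp: space_prob_algebra)

lemma measurable_merge_P:
  assumes "\<Lambda> \<subseteq> {1..n}" "f \<in> N \<rightarrow>\<^sub>M prod_space X \<Lambda>" "g \<in> N \<rightarrow>\<^sub>M P"
  shows "(\<lambda>z. merge \<Lambda> (compl \<Lambda>) (f z, g z)) \<in> N \<rightarrow>\<^sub>M P"
  unfolding measurable_cong_sets[OF refl sets_P] unfolding prod_space_def
  by (rule measurable_merge_superset[OF _ _ order_refl, of _ _ _ _ _ "{1..n}"])
    (use assms in \<open>auto simp: prod_space_def[symmetric] measurable_cong_sets[OF refl sets_P]\<close>)

lemma measurable_update[measurable]:
  assumes \<Lambda>: "block \<Lambda>"
  shows "update \<Lambda> \<in> P \<rightarrow>\<^sub>M prob_algebra P"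
  unfolding update_def
proof (rule measurable_distr_prob_space2)
  show "(\<lambda>x. C \<Lambda> (restrict x (compl \<Lambda>))) \<in> P \<rightarrow>\<^sub>M prob_algebra (prod_space X \<Lambda>)"
    by (rule measurable_compose[OF measurable_restrict_P measurable_conditional[OF \<Lambda>]]) auto
  show "(\<lambda>(x, z). merge \<Lambda> (compl \<Lambda>) (z, x)) \<in> P \<Otimes>\<^sub>M prod_space X \<Lambda> \<rightarrow>\<^sub>M P"
    unfolding case_prod_beta by (rule measurable_merge_P[OF block_subset[OF \<Lambda>]]) auto
qed

lemma measurable_merge_conditional:
  assumes "block \<Lambda>" "x \<in> space P"
  shows "(\<lambda>z. merge \<Lambda> (compl \<Lambda>) (z, x)) \<in> C \<Lambda> (restrict x (compl \<Lambda>)) \<rightarrow>\<^sub>M P"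
  unfolding measurable_cong_sets[OF conditional_at(2)[OF assms] refl]
  by (rule measurable_merge_P[OF block_subset]) (use assms in auto)

lemma update_cong:
  assumes "restrict x (compl \<Lambda>) = restrict y (compl \<Lambda>)"
  shows "update \<Lambda> x = update \<Lambda> y"
proof -
  have "merge \<Lambda> (compl \<Lambda>) (z, x) = merge \<Lambda> (compl \<Lambda>) (z, y)" for z
    by (metis assms merge_restrict)
  then show ?thesis by (simp add: update_def assms )
qed

lemma apply_update_cong:
  "restrict x (compl \<Lambda>) = restrict y (compl \<Lambda>) \<Longrightarrow> kernel_apply (update \<Lambda>) f x = kernel_apply (update \<Lambda>) f y"
  by (simp only: kernel_apply_def update_cong[of x \<Lambda> y])

lemma apply_update:
  assumes "block \<Lambda>" "x \<in> space P" "f \<in> borel_measurable P"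
  shows "kernel_apply (update \<Lambda>) f x
    = (\<integral>z. f (merge \<Lambda> (compl \<Lambda>) (z, x)) \<partial>C \<Lambda> (restrict x (compl \<Lambda>)))"
  unfolding kernel_apply_def update_def
  by (rule integral_distr[OF measurable_merge_conditional[OF assms(1,2)] assms(3)])

lemma emeasure_update_box:
  assumes \<Lambda>: "block \<Lambda>" and x: "x \<in> space P" and A: "\<And>i. i \<in> {1..n} \<Longrightarrow> A i \<in> sets (borel_of (X i))"
  shows "emeasure (update \<Lambda> x) (Pi\<^sub>E {1..n} A)
    = emeasure (C \<Lambda> (restrict x (compl \<Lambda>))) (Pi\<^sub>E \<Lambda> A)
      * indicator (Pi\<^sub>E (compl \<Lambda>) A) (restrict x (compl \<Lambda>))"
proof -
  let ?c = "C \<Lambda> (restrict x (compl \<Lambda>))"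
  have box: "Pi\<^sub>E {1..n} A \<in> sets P"
    unfolding sets_P prod_space_def by (rule sets_PiM_I_finite) (use A in auto)
  have sp: "space ?c = (\<Pi>\<^sub>E i\<in>\<Lambda>. space (borel_of (X i)))"
    using sets_eq_imp_space_eq[OF conditional_at(2)[OF \<Lambda> x]] by (simp add: prod_space_def space_PiM)
  have A': "A i \<subseteq> space (borel_of (X i))" if "i \<in> {1..n}" for i
    using A[OF that] by (rule sets.sets_into_space)
  have sub: "\<Lambda> \<subseteq> {1..n}" by (rule block_subset[OF \<Lambda>])
  have "(\<lambda>z. merge \<Lambda> (compl \<Lambda>) (z, x)) -` Pi\<^sub>E {1..n} A \<inter> space ?c
    = (if restrict x (compl \<Lambda>) \<in> Pi\<^sub>E (compl \<Lambda>) A then Pi\<^sub>E \<Lambda> A else {})"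
  proof (intro set_eqI)
    fix z
    have "merge \<Lambda> (compl \<Lambda>) (z, x) \<in> Pi\<^sub>E {1..n} A
        \<longleftrightarrow> (\<forall>i\<in>\<Lambda>. z i \<in> A i) \<and> (\<forall>i\<in>compl \<Lambda>. x i \<in> A i)"
      using sub by (auto simp: PiE_iff merge_def extensional_def Ball_def)
    moreover have "restrict x (compl \<Lambda>) \<in> Pi\<^sub>E (compl \<Lambda>) A \<longleftrightarrow> (\<forall>i\<in>compl \<Lambda>. x i \<in> A i)"
      by (auto simp: PiE_iff)
    moreover have "z \<in> Pi\<^sub>E \<Lambda> A \<longleftrightarrow> (\<forall>i\<in>\<Lambda>. z i \<in> A i) \<and> z \<in> space ?c"
      using A' sub unfolding sp by (auto simp: PiE_iff subset_iff)
    ultimately show "z \<in> (\<lambda>z. merge \<Lambda> (compl \<Lambda>) (z, x)) -` Pi\<^sub>E {1..n} A \<inter> space ?c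
      \<longleftrightarrow> z \<in> (if restrict x (compl \<Lambda>) \<in> Pi\<^sub>E (compl \<Lambda>) A then Pi\<^sub>E \<Lambda> A else {})"
      by auto
  qed
  then show ?thesis
    unfolding update_def emeasure_distr[OF measurable_merge_conditional[OF \<Lambda> x] box] by simp
qed

text \<open>Measurable boxes determine a finite measure on the product, and on a box the claim is
  the defining equation of the conditional distribution.\<close>

lemma bind_update:
  assumes \<Lambda>: "block \<Lambda>"
  shows "P \<bind> update \<Lambda> = P"
proof (rule measure_eqI_PiM_finite)
  note K = measurable_prob_algebraD[OF measurable_update[OF \<Lambda>]]
  show "finite {1..n}" by simp
  show P: "sets P = sets (\<Pi>\<^sub>M i\<in>{1..n}. borel_of (X i))" using sets_P by (simp add: prod_space_def)
  show "sets (P \<bind> update \<Lambda>) = sets (\<Pi>\<^sub>M i\<in>{1..n}. borel_of (X i))"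
    using P by (subst sets_bind[OF _ not_empty]) (auto simp: update_def)
  \<comment> \<open>The exhausting sequence of boxes is constant, equal to the whole space.\<close>
  show "range (\<lambda>_::nat. space P) \<subseteq> prod_algebra {1..n} (\<lambda>i. borel_of (X i))"
    unfolding space_P prod_space_def space_PiM by (auto intro!: prod_algebraI_finite)
  show "(\<Union>i::nat. space P) = space (\<Pi>\<^sub>M i\<in>{1..n}. borel_of (X i))"
    by (simp add: space_P prod_space_def)
  show "emeasure (P \<bind> update \<Lambda>) (space P) \<noteq> \<infinity>" for i :: nat
  proof -
    interpret B: prob_space "P \<bind> update \<Lambda>"
      by (rule prob_space_bind'[OF _ measurable_update[OF \<Lambda>]]) (simp add: space_prob_algebra prob_space_axioms)
    show ?thesis by simp
  qed
  fix A assume A: "\<And>i. i \<in> {1..n} \<Longrightarrow> A i \<in> sets (borel_of (X i))"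
  have sub: "\<Lambda> \<subseteq> {1..n}" "compl \<Lambda> \<subseteq> {1..n}" using block_subset[OF \<Lambda>] by auto
  have fin: "finite \<Lambda>" "finite (compl \<Lambda>)" using sub finite_subset by auto
  have box: "Pi\<^sub>E {1..n} A \<in> sets P"
    unfolding sets_P prod_space_def by (rule sets_PiM_I_finite) (use A in auto)
  have box1: "Pi\<^sub>E \<Lambda> A \<in> sets (prod_space X \<Lambda>)"
    unfolding prod_space_def using A sub fin by (intro sets_PiM_I_finite) auto
  have box2: "Pi\<^sub>E (compl \<Lambda>) A \<in> sets (prod_space X (compl \<Lambda>))"
    unfolding prod_space_def using A sub fin by (intro sets_PiM_I_finite) auto
  have A': "A i \<subseteq> space (borel_of (X i))" if "i \<in> {1..n}" for i
    using A[OF that] by (rule sets.sets_into_space)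
  have "(\<lambda>y. emeasure (C \<Lambda> y) (Pi\<^sub>E \<Lambda> A)) \<in> borel_measurable (prod_space X (compl \<Lambda>))"
    by (rule measurable_compose[OF measurable_prob_algebraD[OF measurable_conditional[OF \<Lambda>]]
          measurable_emeasure_subprob_algebra[OF box1]])
  then have meas: "(\<lambda>y. emeasure (C \<Lambda> y) (Pi\<^sub>E \<Lambda> A) * indicator (Pi\<^sub>E (compl \<Lambda>) A) y)
      \<in> borel_measurable (prod_space X (compl \<Lambda>))"
    using box2 by simp
  have "emeasure (P \<bind> update \<Lambda>) (Pi\<^sub>E {1..n} A) = (\<integral>\<^sup>+x. emeasure (update \<Lambda> x) (Pi\<^sub>E {1..n} A) \<partial>P)"
    by (rule emeasure_bind[OF not_empty K box])
  also have "\<dots> = (\<integral>\<^sup>+x. emeasure (C \<Lambda> (restrict x (compl \<Lambda>))) (Pi\<^sub>E \<Lambda> A)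
      * indicator (Pi\<^sub>E (compl \<Lambda>) A) (restrict x (compl \<Lambda>)) \<partial>P)"
    by (rule nn_integral_cong) (rule emeasure_update_box[OF \<Lambda> _ A])
  also have "\<dots> = (\<integral>\<^sup>+y\<in>Pi\<^sub>E (compl \<Lambda>) A. emeasure (C \<Lambda> y) (Pi\<^sub>E \<Lambda> A) \<partial>marginal_compl n X P \<Lambda>)"
    unfolding marginal_compl_def
    using nn_integral_distr[OF measurable_restrict_P[OF sub(2)], unfolded measurable_distr_eq1, OF meas]
    by (simp only:)
  also have "\<dots> = emeasure P {x \<in> space P. restrict x \<Lambda> \<in> Pi\<^sub>E \<Lambda> A \<and> restrict x (compl \<Lambda>) \<in> Pi\<^sub>E (compl \<Lambda>) A}"
    by (rule emeasure_conditional[symmetric, OF \<Lambda> box1 box2])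
  also have "{x \<in> space P. restrict x \<Lambda> \<in> Pi\<^sub>E \<Lambda> A \<and> restrict x (compl \<Lambda>) \<in> Pi\<^sub>E (compl \<Lambda>) A} = Pi\<^sub>E {1..n} A"
  proof (rule set_eqI)
    fix x
    have "x \<in> Pi\<^sub>E {1..n} A \<longleftrightarrow> x \<in> space P \<and> (\<forall>i\<in>{1..n}. x i \<in> A i)"
      using A' unfolding space_P prod_space_def space_PiM PiE_iff by blast
    moreover have "(\<forall>i\<in>{1..n}. x i \<in> A i) \<longleftrightarrow> (\<forall>i\<in>\<Lambda>. x i \<in> A i) \<and> (\<forall>i\<in>compl \<Lambda>. x i \<in> A i)"
      using sub by blast
    ultimately show "x \<in> {x \<in> space P. restrict x \<Lambda> \<in> Pi\<^sub>E \<Lambda> A \<and> restrict x (compl \<Lambda>) \<in> Pi\<^sub>E (compl \<Lambda>) A}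
        \<longleftrightarrow> x \<in> Pi\<^sub>E {1..n} A"
      unfolding mem_Collect_eq restrict_PiE_iff by blast
  qed
  finally show "emeasure (P \<bind> update \<Lambda>) (Pi\<^sub>E {1..n} A) = emeasure P (Pi\<^sub>E {1..n} A)" .
qed

text \<open>Resampling \<open>\<Lambda>\<close> moves no coordinate outside
  \<open>\<Lambda>\<close>, so a function of those coordinates keeps its value.\<close>

lemma AE_update_eq:
  fixes \<phi> :: "(nat \<Rightarrow> 'a) \<Rightarrow> real"
  assumes \<Lambda>: "block \<Lambda>" and x: "x \<in> space P" and \<phi>: "\<phi> \<in> borel_measurable P"
    and cong: "\<And>x y. restrict x (compl \<Lambda>) = restrict y (compl \<Lambda>) \<Longrightarrow> \<phi> x = \<phi> y"
  shows "AE y in update \<Lambda> x. \<phi> y = \<phi> x"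
proof -
  have "{y \<in> space P. \<phi> y = \<phi> x} \<in> sets P" using \<phi> by measurable
  moreover have "\<phi> (merge \<Lambda> (compl \<Lambda>) (z, x)) = \<phi> x" for z
    by (rule cong) (auto simp: merge_def restrict_def)
  ultimately show ?thesis
    unfolding update_def by (subst AE_distr_iff[OF measurable_merge_conditional[OF \<Lambda> x]]) auto
qed

lemma proper_kernel_update:
  assumes \<Lambda>: "block \<Lambda>"
  shows "proper_kernel P (update \<Lambda>)"
proof -
  note K = measurable_update[OF \<Lambda>]
  interpret stationary_kernel P "update \<Lambda>"
  proof
    show "(\<integral>\<^sup>+x. emeasure (update \<Lambda> x) A \<partial>P) = emeasure P A" if "A \<in> sets P" for A
      using emeasure_bind[OF not_empty measurable_prob_algebraD[OF K] that] by (simp add: bind_update[OF \<Lambda>])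
  qed (rule K)
  show ?thesis
  proof
    fix f :: "(nat \<Rightarrow> 'a) \<Rightarrow> real" and x assume "f \<in> borel_measurable P" "x \<in> space P"
    then show "AE y in update \<Lambda> x. kernel_apply (update \<Lambda>) f y = kernel_apply (update \<Lambda>) f x"
      by (intro AE_update_eq \<Lambda> borel_measurable_apply) (assumption | erule apply_update_cong)+
  qed
qed

text \<open>\<open>K\<^sub>\<Lambda> f\<close> depends only on coordinates outside
  \<open>\<Lambda>\<close>, and an update of \<open>\<Gamma> \<subseteq> \<Lambda>\<close> freezes
  all of these.\<close>

lemma invariant_apply_update:
  assumes \<Lambda>: "block \<Lambda>" and \<Gamma>: "block \<Gamma>" "\<Gamma> \<subseteq> \<Lambda>" and f: "f \<in> borel_measurable P"
  shows "proper_kernel.invariant P (update \<Gamma>) (kernel_apply (update \<Lambda>) f)"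
proof -
  interpret L: proper_kernel P "update \<Lambda>" by (rule proper_kernel_update[OF \<Lambda>])
  interpret G: proper_kernel P "update \<Gamma>" by (rule proper_kernel_update[OF \<Gamma>(1)])
  have "restrict x (compl \<Lambda>) = restrict y (compl \<Lambda>)"
    if eq: "restrict x (compl \<Gamma>) = restrict y (compl \<Gamma>)" for x y :: "nat \<Rightarrow> 'a"
  proof (rule restrict_ext)
    fix i assume "i \<in> compl \<Lambda>"
    then show "x i = y i" using fun_cong[OF eq, of i] \<Gamma>(2) by (auto simp: restrict_def split: if_splits)
  qed
  then show ?thesis
    unfolding G.invariant_def using L.borel_measurable_apply[OF f]
    by (blast intro: AE_update_eq[OF \<Gamma>(1)] apply_update_cong)
qed

section \<open>Dirichlet forms of the random-scan kernels\<close>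

text \<open>Not every \<open>f\<close> is integrable under all the kernels \<open>update \<Gamma> x\<close>: the average holds off a null set.\<close>

lemma dirichlet_form_gibbs_T:
  assumes r: "1 \<le> r" "r \<le> n - 1" and f: "square_integrable P f"
  shows "dirichlet_form P (gibbs_T n X C r) f
    = (\<Sum>\<Lambda> | \<Lambda> \<subseteq> {1..n} \<and> card \<Lambda> = r. dirichlet_form P (update \<Lambda>) f) / of_nat (n choose r)"
proof -
  define S where "S = {\<Lambda>. \<Lambda> \<subseteq> {1..n} \<and> card \<Lambda> = r}"
  have fin: "finite S" by (simp add: S_def)
  have card: "card S = n choose r" using n_subsets[of "{1..n}" r] by (simp add: S_def)
  have block: "block \<Lambda>" if "\<Lambda> \<in> S" for \<Lambda> using that r by (simp add: S_def block_def)
  note proper = proper_kernel_update[OF block]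
  note [measurable] = square_integrableD(1)[OF f]
  define Tf where "Tf x = (\<Sum>\<Lambda>\<in>S. kernel_apply (update \<Lambda>) f x) / of_nat (n choose r)" for x
  have T_eq: "gibbs_T n X C r x = subset_average P {1..n} r (\<lambda>\<Lambda>. update \<Lambda> x)" for x
    unfolding gibbs_T_def subset_average_def space_P sets_P update_eq ..
  have meas: "gibbs_T n X C r \<in> P \<rightarrow>\<^sub>M prob_algebra P"
    unfolding T_eq[abs_def]
    by (rule measurable_subset_average) (use r block in \<open>auto simp: S_def intro!: measurable_update\<close>)
  have Kf[measurable]: "kernel_apply (gibbs_T n X C r) f \<in> borel_measurable P"
    unfolding kernel_apply_def
    by (rule measurable_compose[OF measurable_prob_algebraD[OF meas] integral_measurable_subprob_algebra]) simp
  \<comment> \<open>There are finitely many blocks, so one null set serves all of them.\<close>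
  have int: "AE x in P. \<forall>\<Lambda>\<in>S. integrable (update \<Lambda> x) f"
    unfolding AE_ball_countable[OF countable_finite[OF fin]]
    using stationary_kernel.AE_integrable_kernel[OF proper_kernel.axioms(1)[OF proper] square_integrable_integrable[OF f]]
    by blast
  have sq: "square_integrable P (kernel_apply (update \<Lambda>) f)" if "\<Lambda> \<in> S" for \<Lambda>
    by (rule stationary_kernel.square_integrable_apply[OF proper_kernel.axioms(1)[OF proper[OF that]] f])
  have "AE x in P. kernel_apply (gibbs_T n X C r) f x = Tf x"
    using int AE_space
  proof eventually_elim
    case (elim x)
    have "(\<integral>y. f y \<partial>subset_average P {1..n} r (\<lambda>\<Lambda>. update \<Lambda> x))
        = (\<Sum>\<Lambda> | \<Lambda> \<subseteq> {1..n} \<and> card \<Lambda> = r. \<integral>y. f y \<partial>update \<Lambda> x) / of_nat (card {1..n} choose r)"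
      using r elim measurable_space[OF measurable_update[OF block]]
      by (intro integral_subset_average) (auto simp: S_def)
    then show ?case by (simp add: kernel_apply_def T_eq Tf_def S_def)
  qed
  moreover have [measurable]: "Tf \<in> borel_measurable P"
    unfolding Tf_def using square_integrableD(1)[OF sq]
    by (intro borel_measurable_divide borel_measurable_sum) auto
  ultimately have "(\<integral>x. f x * kernel_apply (gibbs_T n X C r) f x \<partial>P) = (\<integral>x. f x * Tf x \<partial>P)"
    by (intro integral_cong_AE) auto
  also have "\<dots> = (\<integral>x. (\<Sum>\<Lambda>\<in>S. f x * kernel_apply (update \<Lambda>) f x) / of_nat (n choose r) \<partial>P)"
    by (simp add: Tf_def sum_distrib_left)
  also have "\<dots> = (\<Sum>\<Lambda>\<in>S. \<integral>x. f x * kernel_apply (update \<Lambda>) f x \<partial>P) / of_nat (n choose r)"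
    using square_integrable_mult[OF f sq] by simp
  finally have "(\<integral>x. f x * kernel_apply (gibbs_T n X C r) f x \<partial>P) = \<dots>" .
  \<comment> \<open>Averaging the constant squared norm of \<open>f\<close> over \<open>S\<close>
    returns it because \<open>S\<close> is nonempty.\<close>
  moreover have "n choose r > 0" using r by simp
  ultimately show ?thesis
    by (simp add: dirichlet_form_eq sum_subtractf diff_divide_distrib card flip: S_def)
qed

section \<open>The kernels on a fibre and the spectral gap bound\<close>

definition component_Q :: "nat set \<Rightarrow> (nat \<Rightarrow> 'a) \<Rightarrow> nat set \<Rightarrow> (nat \<Rightarrow> 'a) \<Rightarrow> (nat \<Rightarrow> 'a) measure" where
  "component_Q \<Lambda> y \<Gamma> u = distr (C \<Gamma> (merge (\<Lambda> - \<Gamma>) (compl \<Lambda>) (u, y))) (prod_space X \<Lambda>)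
    (\<lambda>z. merge \<Gamma> (\<Lambda> - \<Gamma>) (z, u))"

lemma gibbs_Q_eq: "gibbs_Q n X C m \<Lambda> y u = subset_average (prod_space X \<Lambda>) \<Lambda> m (\<lambda>\<Gamma>. component_Q \<Lambda> y \<Gamma> u)"
  by (simp add: gibbs_Q_def component_Q_def)

lemma measurable_component_Q:
  assumes \<Lambda>: "block \<Lambda>" and \<Gamma>: "block \<Gamma>" "\<Gamma> \<subseteq> \<Lambda>" and y: "y \<in> space (prod_space X (compl \<Lambda>))"
  shows "component_Q \<Lambda> y \<Gamma> \<in> prod_space X \<Lambda> \<rightarrow>\<^sub>M prob_algebra (prod_space X \<Lambda>)"
  unfolding component_Q_def
proof (rule measurable_distr_prob_space2)
  have "(\<lambda>u. merge (\<Lambda> - \<Gamma>) (compl \<Lambda>) (u, y)) \<in> prod_space X \<Lambda> \<rightarrow>\<^sub>M prod_space X (compl \<Gamma>)"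
    unfolding prod_space_def
  proof (rule measurable_merge_superset)
    show "(\<lambda>u. u) \<in> Pi\<^sub>M \<Lambda> (\<lambda>i. borel_of (X i)) \<rightarrow>\<^sub>M Pi\<^sub>M \<Lambda> (\<lambda>i. borel_of (X i))" by simp
    show "(\<lambda>u. y) \<in> Pi\<^sub>M \<Lambda> (\<lambda>i. borel_of (X i)) \<rightarrow>\<^sub>M Pi\<^sub>M (compl \<Lambda>) (\<lambda>i. borel_of (X i))"
      using y by (simp add: prod_space_def)
    show "compl \<Gamma> = (\<Lambda> - \<Gamma>) \<union> compl \<Lambda>" using \<Gamma>(2) block_subset[OF \<Lambda>] by auto
  qed auto
  then show "(\<lambda>u. C \<Gamma> (merge (\<Lambda> - \<Gamma>) (compl \<Lambda>) (u, y))) \<in> prod_space X \<Lambda> \<rightarrow>\<^sub>M prob_algebra (prod_space X \<Gamma>)"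
    by (rule measurable_compose[OF _ measurable_conditional[OF \<Gamma>(1)]])
  show "(\<lambda>(u, z). merge \<Gamma> (\<Lambda> - \<Gamma>) (z, u)) \<in> prod_space X \<Lambda> \<Otimes>\<^sub>M prod_space X \<Gamma> \<rightarrow>\<^sub>M prod_space X \<Lambda>"
    unfolding prod_space_def case_prod_beta
    by (rule measurable_merge_superset[OF measurable_snd measurable_fst]) (use \<Gamma>(2) in auto)
qed

text \<open>The map \<open>v \<mapsto> merge \<Lambda> (compl \<Lambda>) (v, x)\<close> embeds the
  fibre into the full space and carries the \<open>\<Gamma>\<close>-part of the fibre kernel to
  \<open>update \<Gamma>\<close>. Integrals of sections of \<open>h\<close> thus become values of
  \<open>K\<^sub>\<Gamma> h\<close>.\<close>

lemma
  fixes h :: "(nat \<Rightarrow> 'a) \<Rightarrow> real"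
  assumes \<Lambda>: "block \<Lambda>" and \<Gamma>: "block \<Gamma>" "\<Gamma> \<subseteq> \<Lambda>" and x: "x \<in> space P"
    and u: "u \<in> space (prod_space X \<Lambda>)" and h: "h \<in> borel_measurable P"
  shows integral_component_Q:
      "(\<integral>v. h (merge \<Lambda> (compl \<Lambda>) (v, x)) \<partial>component_Q \<Lambda> (restrict x (compl \<Lambda>)) \<Gamma> u)
        = kernel_apply (update \<Gamma>) h (merge \<Lambda> (compl \<Lambda>) (u, x))" (is "?int")
    and integrable_component_Q:
      "integrable (update \<Gamma> (merge \<Lambda> (compl \<Lambda>) (u, x))) h \<Longrightarrow>
        integrable (component_Q \<Lambda> (restrict x (compl \<Lambda>)) \<Gamma> u) (\<lambda>v. h (merge \<Lambda> (compl \<Lambda>) (v, x)))" (is "PROP ?able")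
proof -
  define e where "e v = merge \<Lambda> (compl \<Lambda>) (v, x)" for v
  have sub: "\<Lambda> \<subseteq> {1..n}" by (rule block_subset[OF \<Lambda>])
  have e[measurable]: "e \<in> prod_space X \<Lambda> \<rightarrow>\<^sub>M P"
    unfolding e_def using x by (intro measurable_merge_P[OF sub]) auto
  have eu: "e u \<in> space P" by (rule measurable_space[OF e u])
  \<comment> \<open>Both kernels condition on the same point: \<open>u\<close> on
    \<open>\<Lambda> - \<Gamma>\<close> and \<open>x\<close> outside
    \<open>\<Lambda>\<close>.\<close>
  have arg: "merge (\<Lambda> - \<Gamma>) (compl \<Lambda>) (u, restrict x (compl \<Lambda>)) = restrict (e u) (compl \<Gamma>)"
    using \<Gamma>(2) sub by (auto simp: e_def merge_def restrict_def fun_eq_iff)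
  have e_merge: "e (merge \<Gamma> (\<Lambda> - \<Gamma>) (z, u)) = merge \<Gamma> (compl \<Gamma>) (z, e u)" for z
    using \<Gamma>(2) sub by (auto simp: e_def merge_def fun_eq_iff)
  let ?c = "C \<Gamma> (restrict (e u) (compl \<Gamma>))"
  have merge: "(\<lambda>z. merge \<Gamma> (\<Lambda> - \<Gamma>) (z, u)) \<in> ?c \<rightarrow>\<^sub>M prod_space X \<Lambda>"
    unfolding measurable_cong_sets[OF conditional_at(2)[OF \<Gamma>(1) eu] refl]
    unfolding prod_space_def
  proof (rule measurable_merge_superset)
    show "(\<lambda>u. u) \<in> Pi\<^sub>M \<Gamma> (\<lambda>i. borel_of (X i)) \<rightarrow>\<^sub>M Pi\<^sub>M \<Gamma> (\<lambda>i. borel_of (X i))" by simp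
    show "(\<lambda>_. u) \<in> Pi\<^sub>M \<Gamma> (\<lambda>i. borel_of (X i)) \<rightarrow>\<^sub>M Pi\<^sub>M \<Lambda> (\<lambda>i. borel_of (X i))"
      using u by (simp add: prod_space_def)
  qed (use \<Gamma>(2) in auto)
  have he: "(\<lambda>v. h (e v)) \<in> borel_measurable (prod_space X \<Lambda>)" by (rule measurable_compose[OF e h])
  show ?int
    unfolding component_Q_def arg e_def[symmetric] integral_distr[OF merge he] e_merge
    by (rule apply_update[OF \<Gamma>(1) eu h, symmetric])
  show "PROP ?able"
    unfolding component_Q_def arg e_def[symmetric] integrable_distr_eq[OF merge he] e_merge update_def
    using integrable_distr_eq[OF measurable_merge_conditional[OF \<Gamma>(1) eu] h] by simp
qed

text \<open>The gap inequality is applied to the section of the residual \<open>h\<close> on each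
  fibre and then integrated; invariance of \<open>K\<^sub>\<Lambda> f\<close> finally replaces
  \<open>h\<close> by \<open>f\<close>.\<close>

lemma dirichlet_form_update_ge:
  assumes \<Lambda>: "block \<Lambda>" and m: "1 \<le> m" "m \<le> card \<Lambda>" and f: "square_integrable P f"
    and gap: "AE y in marginal_compl n X P \<Lambda>. \<forall>g\<in>L20 (C \<Lambda> y). \<not> (AE u in C \<Lambda> y. g u = 0) \<longrightarrow>
      c \<le> dirichlet_form (C \<Lambda> y) (gibbs_Q n X C m \<Lambda> y) g / (L2_norm (C \<Lambda> y) g)\<^sup>2"
  shows "c * dirichlet_form P (update \<Lambda>) f
    \<le> (\<Sum>\<Gamma> | \<Gamma> \<subseteq> \<Lambda> \<and> card \<Gamma> = m. dirichlet_form P (update \<Gamma>) f) / of_nat (card \<Lambda> choose m)"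
proof -
  interpret L: proper_kernel P "update \<Lambda>" by (rule proper_kernel_update[OF \<Lambda>])
  define S where "S = {\<Gamma>. \<Gamma> \<subseteq> \<Lambda> \<and> card \<Gamma> = m}"
  define d :: real where "d = of_nat (card \<Lambda> choose m)"
  have fin\<Lambda>: "finite \<Lambda>" using block_subset[OF \<Lambda>] finite_subset by auto
  have fin: "finite S" by (simp add: S_def fin\<Lambda>)
  have card: "real (card S) = d" using n_subsets[OF fin\<Lambda>, of m] by (simp add: S_def d_def)
  have d: "d > 0" using m by (simp add: d_def)
  have S: "block \<Gamma>" "\<Gamma> \<subseteq> \<Lambda>" if "\<Gamma> \<in> S" for \<Gamma>
    using that m \<Lambda> by (auto simp: S_def block_def)
  note proper = proper_kernel_update[OF S(1)]
  note stationary = proper_kernel.axioms(1)[OF proper]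
  define \<phi> where "\<phi> = kernel_apply (update \<Lambda>) f"
  define h where "h = (\<lambda>x. f x - \<phi> x)"
  have \<phi>: "square_integrable P \<phi>" unfolding \<phi>_def by (rule L.square_integrable_apply[OF f])
  have h: "square_integrable P h" unfolding h_def by (rule square_integrable_diff[OF f \<phi>])
  \<comment> \<open>On the fibre of \<open>x\<close>, \<open>Th\<close> restricts almost everywhere
    to the fibre kernel applied to the section of \<open>h\<close>.\<close>
  define Th where "Th x = (\<Sum>\<Gamma>\<in>S. kernel_apply (update \<Gamma>) h x) / d" for x
  have Kh: "square_integrable P (kernel_apply (update \<Gamma>) h)" if "\<Gamma> \<in> S" for \<Gamma>
    by (rule stationary_kernel.square_integrable_apply[OF stationary[OF that] h])
  have "square_integrable P (\<lambda>x. \<Sum>\<Gamma>\<in>S. kernel_apply (update \<Gamma>) h x)"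
    by (rule square_integrable_sum[OF Kh])
  then have Th: "square_integrable P Th"
    unfolding square_integrable_def Th_def[abs_def] power_divide
    by (intro conjI borel_measurable_divide borel_measurable_const) auto
  note [measurable] = square_integrableD(1)[OF f] square_integrableD(1)[OF \<phi>]
    square_integrableD(1)[OF h] square_integrableD(1)[OF Th]
  have int: "AE x in P. \<forall>\<Gamma>\<in>S. integrable (update \<Gamma> x) h"
    by (rule AE_finite_allI[OF fin])
      (rule stationary_kernel.AE_integrable_kernel[OF stationary square_integrable_integrable[OF h]])
  have int_meas: "Measurable.pred P (\<lambda>x. \<forall>\<Gamma>\<in>S. integrable (update \<Gamma> x) h)"
  proof -
    have "(\<lambda>x. integrable (update \<Gamma> x) h) \<in> P \<rightarrow>\<^sub>M count_space UNIV" if "\<Gamma> \<in> S" for \<Gamma>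
      by (rule measurable_compose[OF measurable_prob_algebraD[OF measurable_update[OF S(1)[OF that]]]
            integrable_measurable_subprob_algebra]) simp
    then show ?thesis by (rule pred_intros_finite(3)[OF fin])
  qed
  \<comment> \<open>The gap holds for almost every \<open>y\<close> under the marginal, which is the
    image of \<open>P\<close> under restriction, so it can be pulled back to
    \<open>P\<close>.\<close>
  have gap': "AE x in P. \<forall>g\<in>L20 (C \<Lambda> (restrict x (compl \<Lambda>))).
      \<not> (AE u in C \<Lambda> (restrict x (compl \<Lambda>)). g u = 0) \<longrightarrow>
      c \<le> dirichlet_form (C \<Lambda> (restrict x (compl \<Lambda>))) (gibbs_Q n X C m \<Lambda> (restrict x (compl \<Lambda>))) g
        / (L2_norm (C \<Lambda> (restrict x (compl \<Lambda>))) g)\<^sup>2"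
    by (rule AE_distrD[OF measurable_restrict_P gap[unfolded marginal_compl_def]]) auto

  \<comment> \<open>This is the gap inequality multiplied by the squared norm of the section. On the
    fibre of \<open>x\<close>, \<open>K\<^sub>\<Lambda>\<close> of a function is the integral of its
    section against the conditional law.\<close>
  have pointwise: "AE x in P. c * kernel_apply (update \<Lambda>) (\<lambda>x. (h x)\<^sup>2) x
      \<le> kernel_apply (update \<Lambda>) (\<lambda>x. (h x)\<^sup>2) x - kernel_apply (update \<Lambda>) (\<lambda>x. h x * Th x) x"
    using gap' L.AE_square_integrable_kernel[OF f] L.AE_square_integrable_kernel[OF h]
      L.AE_square_integrable_kernel[OF \<phi>] L.AE_kernel[OF int_meas int] AE_space
  proof eventually_elim
    case (elim x)
    note x = \<open>x \<in> space P\<close>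
    define y where "y = restrict x (compl \<Lambda>)"
    define e where "e u = merge \<Lambda> (compl \<Lambda>) (u, x)" for u
    define g where "g u = h (e u)" for u
    let ?\<mu> = "C \<Lambda> y" and ?K = "kernel_apply (update \<Lambda>)"
    interpret Lx: prob_space "update \<Lambda> x" by (rule L.prob_space_kernel[OF x])
    have sets_\<mu>: "sets ?\<mu> = sets (prod_space X \<Lambda>)" unfolding y_def by (rule conditional_at(2)[OF \<Lambda> x])
    have space_\<mu>: "space ?\<mu> = space (prod_space X \<Lambda>)" by (rule sets_eq_imp_space_eq[OF sets_\<mu>])
    have e[measurable]: "e \<in> ?\<mu> \<rightarrow>\<^sub>M P"
      unfolding e_def y_def by (rule measurable_merge_conditional[OF \<Lambda> x])
    have upd: "update \<Lambda> x = distr ?\<mu> P e" by (simp add: update_def y_def e_def[abs_def])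
    have K: "?K F x = (\<integral>u. F (e u) \<partial>?\<mu>)" if "F \<in> borel_measurable P" for F
      unfolding e_def y_def by (rule apply_update[OF \<Lambda> x that])
    have g[measurable]: "g \<in> borel_measurable ?\<mu>" unfolding g_def by measurable
    have g': "g \<in> borel_measurable (prod_space X \<Lambda>)" using g by (simp add: measurable_cong_sets[OF sets_\<mu> refl])

    \<comment> \<open>The section is centred because \<open>K\<^sub>\<Lambda>\<close> fixes
      \<open>\<phi> = K\<^sub>\<Lambda> f\<close>.\<close>
    have "?K h x = ?K f x - ?K \<phi> x"
      using elim by (simp add: kernel_apply_def h_def Lx.square_integrable_integrable)
    also have "?K \<phi> x = \<phi> x"
    proof -
      have "L.invariant \<phi>" unfolding \<phi>_def by (rule L.invariant_apply) simp
      from L.apply_invariant_mult[OF this _ x, of "\<lambda>_. 1"] show ?thesis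
        by (simp add: kernel_apply_def Lx.prob_space)
    qed
    finally have "(\<integral>u. g u \<partial>?\<mu>) = 0" by (simp add: K g_def \<phi>_def)
    moreover have "integrable ?\<mu> (\<lambda>u. (g u)\<^sup>2)"
    proof -
      have "integrable (distr ?\<mu> P e) (\<lambda>x. (h x)\<^sup>2)"
        using elim(3) by (simp add: square_integrable_def upd)
      then show ?thesis by (simp add: integrable_distr_eq g_def)
    qed
    ultimately have L20: "g \<in> L20 ?\<mu>" by (simp add: L20_def)

    have Q: "component_Q \<Lambda> y \<Gamma> \<in> prod_space X \<Lambda> \<rightarrow>\<^sub>M prob_algebra (prod_space X \<Lambda>)" if "\<Gamma> \<in> S" for \<Gamma>
      unfolding y_def by (rule measurable_component_Q[OF \<Lambda> S[OF that] restrict_compl_space[OF x]])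
    have "gibbs_Q n X C m \<Lambda> y \<in> prod_space X \<Lambda> \<rightarrow>\<^sub>M prob_algebra (prod_space X \<Lambda>)"
      unfolding gibbs_Q_eq[abs_def]
      by (rule measurable_subset_average[OF fin\<Lambda> m(2)]) (use Q in \<open>auto simp: S_def\<close>)
    then have "(\<lambda>u. \<integral>v. g v \<partial>gibbs_Q n X C m \<Lambda> y u) \<in> borel_measurable (prod_space X \<Lambda>)"
      by (rule measurable_compose[OF measurable_prob_algebraD integral_measurable_subprob_algebra]) (rule g')
    then have Qg[measurable]: "kernel_apply (gibbs_Q n X C m \<Lambda> y) g \<in> borel_measurable ?\<mu>"
      by (simp add: kernel_apply_def[abs_def] measurable_cong_sets[OF sets_\<mu> refl])
    \<comment> \<open>By \<open>L.AE_kernel\<close> the exceptional null set of \<open>P\<close> is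
      null under \<open>update \<Lambda> x\<close>, and this transfers to the fibre through
      \<open>e\<close>.\<close>
    have "AE u in ?\<mu>. \<forall>\<Gamma>\<in>S. integrable (update \<Gamma> (e u)) h"
      by (rule AE_distrD[OF e elim(5)[unfolded upd]])
    then have "AE u in ?\<mu>. kernel_apply (gibbs_Q n X C m \<Lambda> y) g u = Th (e u)"
      using AE_space
    proof eventually_elim
      case (elim u)
      then have u: "u \<in> space (prod_space X \<Lambda>)" by (simp add: space_\<mu>)
      have "kernel_apply (gibbs_Q n X C m \<Lambda> y) g u = (\<Sum>\<Gamma>\<in>S. \<integral>v. g v \<partial>component_Q \<Lambda> y \<Gamma> u) / d"
        unfolding kernel_apply_def gibbs_Q_eq S_def d_def
      proof (rule integral_subset_average[OF fin\<Lambda> m(2) _ g'])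
        fix \<Gamma> assume "\<Gamma> \<subseteq> \<Lambda>" "card \<Gamma> = m"
        then have \<Gamma>: "\<Gamma> \<in> S" by (simp add: S_def)
        show "component_Q \<Lambda> y \<Gamma> u \<in> space (prob_algebra (prod_space X \<Lambda>))"
          by (rule measurable_space[OF Q[OF \<Gamma>] u])
        show "integrable (component_Q \<Lambda> y \<Gamma> u) g"
          unfolding g_def[abs_def] e_def y_def
          by (rule integrable_component_Q[OF \<Lambda> S[OF \<Gamma>] x u]) (use elim \<Gamma> in \<open>auto simp: e_def\<close>)
      qed
      also have "(\<Sum>\<Gamma>\<in>S. \<integral>v. g v \<partial>component_Q \<Lambda> y \<Gamma> u) = (\<Sum>\<Gamma>\<in>S. kernel_apply (update \<Gamma>) h (e u))"
        unfolding g_def e_def y_def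
        by (intro sum.cong refl integral_component_Q[OF \<Lambda> S x u]) auto
      finally show ?case by (simp add: Th_def)
    qed
    then have "(\<integral>u. g u * kernel_apply (gibbs_Q n X C m \<Lambda> y) g u \<partial>?\<mu>) = (\<integral>u. g u * Th (e u) \<partial>?\<mu>)"
      by (intro integral_cong_AE) auto
    also have "\<dots> = ?K (\<lambda>x. h x * Th x) x" by (simp add: K g_def)
    finally have D: "dirichlet_form ?\<mu> (gibbs_Q n X C m \<Lambda> y) g
        = ?K (\<lambda>x. (h x)\<^sup>2) x - ?K (\<lambda>x. h x * Th x) x"
      by (simp add: dirichlet_form_eq K g_def)
    have norm: "(L2_norm ?\<mu> g)\<^sup>2 = ?K (\<lambda>x. (h x)\<^sup>2) x"
      by (simp add: L2_norm_def L2_inner_def K g_def power2_eq_square)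
    \<comment> \<open>The gap inequality concerns nonzero sections only; for a section that vanishes
      almost everywhere both sides are 0.\<close>
    show ?case
    proof (cases "AE u in ?\<mu>. g u = 0")
      case True
      have "(\<integral>u. (g u)\<^sup>2 \<partial>?\<mu>) = 0"
        by (rule integral_eq_zero_AE) (use True in auto)
      moreover have "(\<integral>u. g u * Th (e u) \<partial>?\<mu>) = 0"
        by (rule integral_eq_zero_AE) (use True in auto)
      ultimately show ?thesis by (simp add: K g_def)
    next
      case False
      have "(\<integral>u. (g u)\<^sup>2 \<partial>?\<mu>) \<noteq> 0"
        using False L20 by (subst integral_nonneg_eq_0_iff_AE) (auto simp: L20_def)
      moreover have "0 \<le> (\<integral>u. (g u)\<^sup>2 \<partial>?\<mu>)" by simp
      ultimately have "0 < (\<integral>u. (g u)\<^sup>2 \<partial>?\<mu>)" by linarith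
      then have "0 < ?K (\<lambda>x. (h x)\<^sup>2) x" by (simp add: K g_def)
      moreover have "c \<le> dirichlet_form ?\<mu> (gibbs_Q n X C m \<Lambda> y) g / (L2_norm ?\<mu> g)\<^sup>2"
        by (rule elim(1)[folded y_def, rule_format, OF L20 False])
      ultimately show ?thesis by (simp add: D norm pos_le_divide_eq)
    qed
  qed

  have h2: "integrable P (kernel_apply (update \<Lambda>) (\<lambda>x. (h x)\<^sup>2))"
    "(\<integral>x. kernel_apply (update \<Lambda>) (\<lambda>x. (h x)\<^sup>2) x \<partial>P) = (\<integral>x. (h x)\<^sup>2 \<partial>P)"
    by (rule L.integrable_apply L.integral_apply, rule square_integrableD(2)[OF h])+
  have hTh: "integrable P (kernel_apply (update \<Lambda>) (\<lambda>x. h x * Th x))"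
    "(\<integral>x. kernel_apply (update \<Lambda>) (\<lambda>x. h x * Th x) x \<partial>P) = (\<integral>x. h x * Th x \<partial>P)"
    by (rule L.integrable_apply L.integral_apply, rule square_integrable_mult[OF h Th])+
  have "c * dirichlet_form P (update \<Lambda>) f = c * (\<integral>x. (h x)\<^sup>2 \<partial>P)"
    by (simp add: L.dirichlet_form_eq_residual[OF f] h_def \<phi>_def)
  \<comment> \<open>Stationarity of \<open>K\<^sub>\<Lambda>\<close> inserts the fibre integrals,
    after which \<open>pointwise\<close> can be integrated.\<close>
  also have "\<dots> = (\<integral>x. c * kernel_apply (update \<Lambda>) (\<lambda>x. (h x)\<^sup>2) x \<partial>P)"
    by (simp add: h2)
  also have "\<dots> \<le> (\<integral>x. kernel_apply (update \<Lambda>) (\<lambda>x. (h x)\<^sup>2) x - kernel_apply (update \<Lambda>) (\<lambda>x. h x * Th x) x \<partial>P)"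
    by (rule integral_mono_AE) (use h2 hTh pointwise in auto)
  also have "\<dots> = (\<integral>x. (h x)\<^sup>2 \<partial>P) - (\<integral>x. h x * Th x \<partial>P)"
    by (simp add: h2 hTh)
  also have "(\<integral>x. h x * Th x \<partial>P) = (\<integral>x. (\<Sum>\<Gamma>\<in>S. h x * kernel_apply (update \<Gamma>) h x) / d \<partial>P)"
    by (simp add: Th_def sum_distrib_left)
  also have "\<dots> = (\<Sum>\<Gamma>\<in>S. \<integral>x. h x * kernel_apply (update \<Gamma>) h x \<partial>P) / d"
    using square_integrable_mult[OF h Kh] by simp
  also have "(\<integral>x. (h x)\<^sup>2 \<partial>P) - \<dots> = (\<Sum>\<Gamma>\<in>S. dirichlet_form P (update \<Gamma>) h) / d"
    using d by (simp add: dirichlet_form_eq sum_subtractf diff_divide_distrib card)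
  also have "(\<Sum>\<Gamma>\<in>S. dirichlet_form P (update \<Gamma>) h) = (\<Sum>\<Gamma>\<in>S. dirichlet_form P (update \<Gamma>) f)"
  proof (rule sum.cong)
    fix \<Gamma> assume \<Gamma>: "\<Gamma> \<in> S"
    have "proper_kernel.invariant P (update \<Gamma>) \<phi>"
      unfolding \<phi>_def by (rule invariant_apply_update[OF \<Lambda> S[OF \<Gamma>]]) simp
    then show "dirichlet_form P (update \<Gamma>) h = dirichlet_form P (update \<Gamma>) f"
      unfolding h_def by (rule proper_kernel.dirichlet_form_diff_invariant[OF proper[OF \<Gamma>] _ \<phi> f])
  qed simp
  finally show ?thesis by (simp add: S_def d_def)
qed

end

section \<open>Double counting of nested subsets\<close>

text \<open>Every \<open>\<Gamma>\<close> of size \<open>m\<close> lies in the same number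
  \<open>N\<close> of sets \<open>\<Lambda>\<close> of size \<open>l\<close>; hence a uniform
  \<open>m\<close>-subset of a uniform \<open>l\<close>-subset is a uniform \<open>m\<close>-subset
  of \<open>I\<close>.\<close>

lemma average_subsets_nested:
  fixes a :: "'i set \<Rightarrow> real"
  assumes I: "finite I" and "m \<le> l" "l \<le> card I"
  shows "(\<Sum>\<Lambda> | \<Lambda> \<subseteq> I \<and> card \<Lambda> = l. (\<Sum>\<Gamma> | \<Gamma> \<subseteq> \<Lambda> \<and> card \<Gamma> = m. a \<Gamma>) / of_nat (l choose m)) / of_nat (card I choose l)
    = (\<Sum>\<Gamma> | \<Gamma> \<subseteq> I \<and> card \<Gamma> = m. a \<Gamma>) / of_nat (card I choose m)"
proof -
  define N where "N = card I - m choose (l - m)"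
  have card: "card {\<Lambda>. \<Lambda> \<subseteq> I \<and> card \<Lambda> = l \<and> \<Gamma> \<subseteq> \<Lambda>} = N" if \<Gamma>: "\<Gamma> \<subseteq> I" "card \<Gamma> = m" for \<Gamma>
  proof -
    have fin: "finite \<Gamma>" by (rule finite_subset[OF \<Gamma>(1) I])
    \<comment> \<open>A superset of \<open>\<Gamma>\<close> of size \<open>l\<close> amounts to a
      choice of its \<open>l - m\<close> further elements.\<close>
    have "bij_betw (\<lambda>D. \<Gamma> \<union> D) {D. D \<subseteq> I - \<Gamma> \<and> card D = l - m} {\<Lambda>. \<Lambda> \<subseteq> I \<and> card \<Lambda> = l \<and> \<Gamma> \<subseteq> \<Lambda>}"
    proof (rule bij_betwI)
      show "(\<lambda>D. \<Gamma> \<union> D) \<in> {D. D \<subseteq> I - \<Gamma> \<and> card D = l - m} \<rightarrow> {\<Lambda>. \<Lambda> \<subseteq> I \<and> card \<Lambda> = l \<and> \<Gamma> \<subseteq> \<Lambda>}"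
      proof (rule Pi_I)
        fix D assume D: "D \<in> {D. D \<subseteq> I - \<Gamma> \<and> card D = l - m}"
        then have "finite D" using I finite_subset by blast
        moreover have "\<Gamma> \<inter> D = {}" using D by blast
        ultimately have "card (\<Gamma> \<union> D) = l" using card_Un_disjoint[OF fin] D \<Gamma> \<open>m \<le> l\<close> by simp
        then show "\<Gamma> \<union> D \<in> {\<Lambda>. \<Lambda> \<subseteq> I \<and> card \<Lambda> = l \<and> \<Gamma> \<subseteq> \<Lambda>}" using D \<Gamma> by blast
      qed
      show "(\<lambda>\<Lambda>. \<Lambda> - \<Gamma>) \<in> {\<Lambda>. \<Lambda> \<subseteq> I \<and> card \<Lambda> = l \<and> \<Gamma> \<subseteq> \<Lambda>} \<rightarrow> {D. D \<subseteq> I - \<Gamma> \<and> card D = l - m}"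
        using \<Gamma>(2) by (auto simp: card_Diff_subset[OF fin])
    qed blast+
    then have "card {\<Lambda>. \<Lambda> \<subseteq> I \<and> card \<Lambda> = l \<and> \<Gamma> \<subseteq> \<Lambda>} = card {D. D \<subseteq> I - \<Gamma> \<and> card D = l - m}"
      by (rule bij_betw_same_card[symmetric])
    also have "\<dots> = N" using I fin \<Gamma> n_subsets[of "I - \<Gamma>" "l - m"] by (simp add: card_Diff_subset N_def)
    finally show ?thesis .
  qed
  have "(\<Sum>\<Lambda> | \<Lambda> \<subseteq> I \<and> card \<Lambda> = l. \<Sum>\<Gamma> | \<Gamma> \<subseteq> \<Lambda> \<and> card \<Gamma> = m. a \<Gamma>)
      = (\<Sum>\<Lambda> | \<Lambda> \<subseteq> I \<and> card \<Lambda> = l. \<Sum>\<Gamma> | \<Gamma> \<in> {\<Gamma>. \<Gamma> \<subseteq> I \<and> card \<Gamma> = m} \<and> \<Gamma> \<subseteq> \<Lambda>. a \<Gamma>)"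
    by (intro sum.cong) auto
  also have "\<dots> = (\<Sum>\<Gamma> | \<Gamma> \<subseteq> I \<and> card \<Gamma> = m. \<Sum>\<Lambda> | \<Lambda> \<in> {\<Lambda>. \<Lambda> \<subseteq> I \<and> card \<Lambda> = l} \<and> \<Gamma> \<subseteq> \<Lambda>. a \<Gamma>)"
    using sum.swap_restrict[of "{\<Lambda>. \<Lambda> \<subseteq> I \<and> card \<Lambda> = l}" "{\<Gamma>. \<Gamma> \<subseteq> I \<and> card \<Gamma> = m}"
        "\<lambda>_. a" "\<lambda>\<Lambda> \<Gamma>. \<Gamma> \<subseteq> \<Lambda>"] I by simp
  also have "\<dots> = (\<Sum>\<Gamma> | \<Gamma> \<subseteq> I \<and> card \<Gamma> = m. N * a \<Gamma>)"
    by (rule sum.cong) (simp_all add: card conj_assoc)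
  finally have "(\<Sum>\<Lambda> | \<Lambda> \<subseteq> I \<and> card \<Lambda> = l. \<Sum>\<Gamma> | \<Gamma> \<subseteq> \<Lambda> \<and> card \<Gamma> = m. a \<Gamma>)
      = N * (\<Sum>\<Gamma> | \<Gamma> \<subseteq> I \<and> card \<Gamma> = m. a \<Gamma>)" by (simp add: sum_distrib_left)
  then have "(\<Sum>\<Lambda> | \<Lambda> \<subseteq> I \<and> card \<Lambda> = l. (\<Sum>\<Gamma> | \<Gamma> \<subseteq> \<Lambda> \<and> card \<Gamma> = m. a \<Gamma>) / of_nat (l choose m)) / of_nat (card I choose l)
      = N * (\<Sum>\<Gamma> | \<Gamma> \<subseteq> I \<and> card \<Gamma> = m. a \<Gamma>) / real ((card I choose l) * (l choose m))"
    by (simp only: sum_divide_distrib[symmetric] divide_divide_eq_left of_nat_mult mult.commute)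
  \<comment> \<open>Both sides count the pairs \<open>\<Gamma> \<subseteq> \<Lambda>\<close> of
    sizes \<open>m\<close> and \<open>l\<close>.\<close>
  also have "(card I choose l) * (l choose m) = (card I choose m) * N"
    unfolding N_def by (rule choose_mult[OF \<open>m \<le> l\<close> \<open>l \<le> card I\<close>])
  also have "N * (\<Sum>\<Gamma> | \<Gamma> \<subseteq> I \<and> card \<Gamma> = m. a \<Gamma>) / real ((card I choose m) * N)
      = (\<Sum>\<Gamma> | \<Gamma> \<subseteq> I \<and> card \<Gamma> = m. a \<Gamma>) / of_nat (card I choose m)"
    using assms by (simp add: N_def)
  finally show ?thesis .
qed

section \<open>Averaging the two bounds over the blocks\<close>

theorem proposition18:
  fixes n l m :: nat
    and X :: "nat \<Rightarrow> 'a topology"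
    and P :: "(nat \<Rightarrow> 'a) measure"
    and C :: "nat set \<Rightarrow> (nat \<Rightarrow> 'a) \<Rightarrow> (nat \<Rightarrow> 'a) measure"
    and c1 :: real
  assumes "\<And>i. i \<in> {1..n} \<Longrightarrow> polish_topology (X i)"
    and "prob_space P"
    and "sets P = sets (prod_space X {1..n})"
    and "conditionals n X P C"
    and "1 \<le> m" and "m < l" and "l \<le> n - 1"
    and "0 \<le> c1" and "c1 \<le> 1"
    and "\<And>\<Lambda>. \<Lambda> \<subseteq> {1..n} \<Longrightarrow> card \<Lambda> = l \<Longrightarrow>
           AE y in marginal_compl n X P \<Lambda>.
             \<forall>g\<in>L20 (C \<Lambda> y). \<not> (AE u in C \<Lambda> y. g u = 0) \<longrightarrow>
               c1 \<le> dirichlet_form (C \<Lambda> y) (gibbs_Q n X C m \<Lambda> y) g / (L2_norm (C \<Lambda> y) g)\<^sup>2"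
  shows "\<forall>f\<in>L20 P.
           c1 * dirichlet_form P (gibbs_T n X C l) f \<le> dirichlet_form P (gibbs_T n X C m) f \<and>
           dirichlet_form P (gibbs_T n X C m) f \<le> dirichlet_form P (gibbs_T n X C l) f"
proof
  fix f assume "f \<in> L20 P"
  then have f: "square_integrable P f" by (simp add: L20_def square_integrable_def)
  interpret gibbs_sampler P n X C
    using assms(2,3,4) by (simp add: gibbs_sampler_def gibbs_sampler_axioms_def)
  let ?D = "\<lambda>\<Lambda>. dirichlet_form P (update \<Lambda>) f"
  let ?SL = "{\<Lambda>. \<Lambda> \<subseteq> {1..n} \<and> card \<Lambda> = l}" and ?SG = "\<lambda>\<Lambda>. {\<Gamma>. \<Gamma> \<subseteq> \<Lambda> \<and> card \<Gamma> = m}"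
  have l: "1 \<le> l" "m \<le> n - 1" "m \<le> l" "l \<le> n" using assms(5-7) by auto
  have block: "block \<Lambda>" if "\<Lambda> \<in> ?SL" for \<Lambda> using that l assms(7) by (simp add: block_def)
  have Tl: "dirichlet_form P (gibbs_T n X C l) f = (\<Sum>\<Lambda>\<in>?SL. ?D \<Lambda>) / of_nat (n choose l)"
    by (rule dirichlet_form_gibbs_T[OF l(1) assms(7) f])
  have "dirichlet_form P (gibbs_T n X C m) f = (\<Sum>\<Gamma>\<in>?SG {1..n}. ?D \<Gamma>) / of_nat (n choose m)"
    by (rule dirichlet_form_gibbs_T[OF assms(5) l(2) f])
  \<comment> \<open>Grouping the blocks of size \<open>m\<close> inside those of size
    \<open>l\<close> makes the two forms comparable one \<open>\<Lambda>\<close> at a time.\<close>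
  also have "\<dots> = (\<Sum>\<Lambda>\<in>?SL. (\<Sum>\<Gamma>\<in>?SG \<Lambda>. ?D \<Gamma>) / of_nat (l choose m)) / of_nat (n choose l)"
    using average_subsets_nested[of "{1..n}" m l ?D] l by simp
  finally have Tm: "dirichlet_form P (gibbs_T n X C m) f = \<dots>" .
  have lower: "c1 * ?D \<Lambda> \<le> (\<Sum>\<Gamma>\<in>?SG \<Lambda>. ?D \<Gamma>) / of_nat (l choose m)" if \<Lambda>: "\<Lambda> \<in> ?SL" for \<Lambda>
    using dirichlet_form_update_ge[OF block[OF \<Lambda>] assms(5) _ f assms(10)] \<Lambda> l by simp
  have upper: "(\<Sum>\<Gamma>\<in>?SG \<Lambda>. ?D \<Gamma>) / of_nat (l choose m) \<le> ?D \<Lambda>" if \<Lambda>: "\<Lambda> \<in> ?SL" for \<Lambda>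
  proof -
    \<comment> \<open>Each \<open>\<Gamma>\<close>-form is below the \<open>\<Lambda>\<close>-form,
      so their average over \<open>\<Gamma>\<close> is too.\<close>
    have "?D \<Gamma> \<le> ?D \<Lambda>" if \<Gamma>: "\<Gamma> \<in> ?SG \<Lambda>" for \<Gamma>
    proof -
      have "block \<Gamma>" using \<Gamma> \<Lambda> l assms(5) by (auto simp: block_def)
      then show ?thesis
        using \<Gamma> block[OF \<Lambda>] f
        by (intro dirichlet_form_le_of_invariant proper_kernel_update invariant_apply_update)
          (auto dest: square_integrableD)
    qed
    then have "(\<Sum>\<Gamma>\<in>?SG \<Lambda>. ?D \<Gamma>) \<le> of_nat (card (?SG \<Lambda>)) * ?D \<Lambda>"
      by (rule sum_bounded_above)
    moreover have "card (?SG \<Lambda>) = l choose m"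
      using n_subsets[of \<Lambda> m] \<Lambda> finite_subset[of \<Lambda> "{1..n}"] by auto
    moreover have "l choose m > 0" using l by simp
    ultimately show ?thesis by (simp add: pos_divide_le_eq mult.commute)
  qed
  have "c1 * (\<Sum>\<Lambda>\<in>?SL. ?D \<Lambda>) \<le> (\<Sum>\<Lambda>\<in>?SL. (\<Sum>\<Gamma>\<in>?SG \<Lambda>. ?D \<Gamma>) / of_nat (l choose m))"
    unfolding sum_distrib_left by (rule sum_mono[OF lower])
  moreover have "(\<Sum>\<Lambda>\<in>?SL. (\<Sum>\<Gamma>\<in>?SG \<Lambda>. ?D \<Gamma>) / of_nat (l choose m)) \<le> (\<Sum>\<Lambda>\<in>?SL. ?D \<Lambda>)"
    by (rule sum_mono[OF upper])
  ultimately show "c1 * dirichlet_form P (gibbs_T n X C l) f \<le> dirichlet_form P (gibbs_T n X C m) f \<and>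
      dirichlet_form P (gibbs_T n X C m) f \<le> dirichlet_form P (gibbs_T n X C l) f"
    unfolding Tl Tm by (simp add: divide_right_mono)
qed

end
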